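(* Let $\Pi$ be a prior probability distribution on $\Omega(\mathcal T)$ such that for some constants $c_0,c_1,c_2,c_3>0$ the following hold for every $\omega=(\rho,\pi)$ in the support of $\Pi$: 1. $\min_{u\in\mathcal V}\rho(u)_v\ge c_0$ for all $v\in[V]$, and $\pi(\varphi)\ge c_1$ for all $\varphi\in\Phi(\mathcal T)$; 2. all component polytopes $\mathcal S_i$ of $\omega$ satisfy the non-obtuse corner property (with a fixed $\delta>0$); and moreover 3. for a specific parameter $\omega^*=(\rho^*,\pi^* )$ in the support of $\Pi$ and for any small $\epsilon>0$, $$\Pi\big(\|\rho(u)-\rho^*(u)\|\le\epsilon\ \ \forall u\in\mathcal V\big)\ge c_2\,\epsilon^{K(V-1)},\qquad \Pi\big(|\pi(\varphi)-\pi^*(\varphi)|\le\epsilon\ \ \forall\varphi\in\Phi(\mathcal T)\big)\ge c_3\,\epsilon^{I-1},$$ and the two events in this display are independent under $\Pi$. Let $X^1_{[n]},\dots,X^m_{[n]}$ be i.i.d. from $P_{n,\omega^*}$. Then: (a) (fixed $n$) for a sufficiently large constant $C$, as $m\to\infty$ with $n$ held fixed, $$\Pi\Big(h(p_{n,\omega^*},p_{n,\omega})>C\sqrt{\tfrac{\log m}{m}}\ \Big|\ X^1_{[n]},\dots,X^m_{[n]}\Big)\to0\quad\text{in } P_{n,\omega^*}^\infty\text{-probability};$$ (b) (increasing $n$) for a sufficiently large constant $C$, as $m,n\to\infty$ such that $\log n=o(m)$, $$\Pi\Big(h(p_{n,\omega^*},p_{n,\omega})>C\sqrt{\tfrac{\log(m\vee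 n)}{m}}\ \Big|\ X^1_{[n]},\dots,X^m_{[n]}\Big)\to0\quad\text{in } P_{n,\omega^*}^\infty\text{-probability}.$$ Here $h$ is the Hellinger metric.
   Context: Fix a vocabulary $[V]=\{1,\dots,V\}$; $\Delta^{d-1}$ is the probability simplex in $\mathbb R^d$. A directed rooted tree (DRT) $\mathcal T=(\mathcal V,\mathcal E,v_0)$ is a finite directed graph whose underlying undirected graph is a tree and which has a unique node $v_0$ (root) of in-degree $0$. A (maximal) path is a tuple of nodes starting at the root, following directed edges, and ending at a leaf; its length is its number of nodes; $\Phi(\mathcal T)$ is the set of such paths. Standing setting: $\mathcal T$ is a fixed known DRT with $K=|\mathcal V|$ nodes and $I=|\Phi(\mathcal T)|$ leaves, all of whose maximal paths have the same length $J$; $\alpha_0>0$ is fixed and known. $\Omega(\mathcal T)$ is the set of pairs $\omega=(\rho,\pi)$ with $\rho:\mathcal V\to\Delta^{V-1}$ injective (a topic map) and $\pi:\Phi(\mathcal T)\to[0,1]$ with $\sum_\varphi\pi(\varphi)=1$. Fix an enumeration $\varphi_1,\dots,\varphi_I$ of $\Phi(\mathcal T)$; $\pi_i=\pi(\varphi_i)$; $\theta_{i,1},\dots,\theta_{i,J}$ are the images under $\rho$ of the nodes of $\varphi_i$; $\mathcal S_i=\operatorname{conv}\{\theta_{i,1},\dots,\theta_{i,J}\}$ is the $i$-th component polytope. $P_{n,\omega}$ is the distribution on $[V]^n$ of a document $X_{[n]}=(X_1,\dots,X_n)$, with probability mass function $$p_{n,\omega}(x_1,\dots,x_n)=\sum_{i=1}^I\pi_i\int_{\Delta^{J-1}}\prod_{v\in[V]}\Big(\sum_{k=1}^{J}\beta_k(\theta_{i,k})_v\Big)^{m_v}\mathrm{Dir}_{J,\alpha_0}(d\beta),\quad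 m_v=\#\{j:x_j=v\},$$ with $\mathrm{Dir}_{J,\alpha_0}$ the symmetric Dirichlet distribution on $\Delta^{J-1}$. Non-obtuse corner property: for a fixed number $\delta>0$, a convex polytope $\mathcal S$ has it if at each vertex of $\mathcal S$ there is a supporting hyperplane whose angle formed with any edge adjacent to that vertex is bounded from below by $\delta$. $\|\cdot\|$ is the Euclidean norm; $m\vee n=\max(m,n)$; $\Pi(\cdot\mid X^1_{[n]},\dots,X^m_{[n]})$ is the posterior distribution of $\omega$. *)

theory Defs
  imports
    "Graph_Theory.Digraph_Component"
    "Graph_Theory.Vertex_Walk"
    "HOL-Probability.Probability"
    "HOL-Library.Landau_Symbols"
begin

section \<open>Directed rooted trees\<close>

text \<open>
  The library predicate \<open>tree\<close> is not usable here: applied to \<open>G\<close> it only forbids directed cycles,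
  and applied to \<open>mk_symmetric G\<close> it rejects every edge, since \<open>u, v, u\<close> counts as a cycle. Hence
  a cycle of the underlying undirected graph is a cycle of \<open>mk_symmetric G\<close> of length at least 3;
  a pair of opposite arcs, which would be an undirected cycle of length 2, is excluded separately.
\<close>

locale directed_rooted_tree = digraph G for G :: "('a, 'b) pre_digraph" (structure) and root :: 'a +
  assumes weakly_connected: "Digraph_Component.connected G"
    and no_undirected_cycle: "\<nexists>p. pre_digraph.cycle (with_proj (mk_symmetric G)) p \<and> 3 \<le> length p"
    and no_opposite_arcs: "(u, v) \<in> arcs_ends G \<Longrightarrow> (v, u) \<notin> arcs_ends G"
    and root_unique: "v \<in> verts G \<and> in_degree G v = 0 \<longleftrightarrow> v = root"

definition maximal_paths :: "('a, 'b) pre_digraph \<Rightarrow> 'a \<Rightarrow> 'a list set" where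
  "maximal_paths T r = {\<phi>. vwalk \<phi> T \<and> hd \<phi> = r \<and> out_degree T (last \<phi>) = 0}"

section \<open>Parameters\<close>

definition prob_simplex :: "(real ^ 'v::finite) set" where
  "prob_simplex = {x. (\<forall>v. 0 \<le> x $ v) \<and> (\<Sum>v\<in>UNIV. x $ v) = 1}"

text \<open>
  Maps on the nodes and on the paths are extensional functions, so that the product topology on the
  function types induces on the parameter set the topology of a subset of a Euclidean space.
\<close>

type_synonym ('a, 'v) param = "('a \<Rightarrow> real ^ 'v) \<times> ('a list \<Rightarrow> real)"

definition topic_params :: "('a, 'b) pre_digraph \<Rightarrow> 'a \<Rightarrow> ('a, 'v::finite) param set" where
  "topic_params T r = {(\<rho>, \<pi>).
     \<rho> \<in> verts T \<rightarrow>\<^sub>E prob_simplex \<and> inj_on \<rho> (verts T) \<and>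
     \<pi> \<in> maximal_paths T r \<rightarrow>\<^sub>E {0..1} \<and> (\<Sum>\<phi>\<in>maximal_paths T r. \<pi> \<phi>) = 1}"

definition param_space :: "('a, 'b) pre_digraph \<Rightarrow> 'a \<Rightarrow> ('a, 'v::finite) param measure" where
  "param_space T r = restrict_space borel (topic_params T r)"

text \<open>The support, relative to the subspace topology on \<open>space M\<close>.\<close>

definition measure_support :: "'c::topological_space measure \<Rightarrow> 'c set" where
  "measure_support M =
     {x \<in> space M. \<forall>U. open U \<and> x \<in> U \<longrightarrow> 0 < emeasure M (U \<inter> space M)}"

section \<open>Non-obtuse corners\<close>

definition component_polytope :: "('a \<Rightarrow> real ^ 'v) \<Rightarrow> 'a list \<Rightarrow> (real ^ 'v) set" where
  "component_polytope \<rho> \<phi> = convex hull (\<rho> ` set \<phi>)"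

text \<open>The angle between the hyperplane with normal vector \<open>a\<close> and a line with direction \<open>d\<close>.\<close>

definition hyperplane_angle :: "'c::real_inner \<Rightarrow> 'c \<Rightarrow> real" where
  "hyperplane_angle a d = arcsin (\<bar>a \<bullet> d\<bar> / (norm a * norm d))"

definition non_obtuse_corners :: "real \<Rightarrow> 'c::euclidean_space set \<Rightarrow> bool" where
  "non_obtuse_corners \<delta> S \<longleftrightarrow>
     (\<forall>x. x extreme_point_of S \<longrightarrow>
       (\<exists>a b. a \<noteq> 0 \<and> a \<bullet> x = b \<and> S \<subseteq> {y. b \<le> a \<bullet> y} \<and>
         (\<forall>F. F edge_of S \<and> x \<in> F \<longrightarrow>
           (\<forall>y\<in>F. y \<noteq> x \<longrightarrow> \<delta> \<le> hyperplane_angle a (y - x)))))"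

section \<open>The document model\<close>

text \<open>
  The standard density with respect to Lebesgue measure in the first \<open>J - 1\<close> coordinates. For
  \<open>J = 1\<close> this is the point mass at the only point of the simplex.
\<close>

definition dirichlet :: "nat \<Rightarrow> real \<Rightarrow> (nat \<Rightarrow> real) measure" where
  "dirichlet J \<alpha> =
     distr
       (density (Pi\<^sub>M {..<J - 1} (\<lambda>_. lborel))
         (\<lambda>x. ennreal
           (if (\<forall>k<J - 1. 0 < x k) \<and> (\<Sum>k<J - 1. x k) < 1
            then Gamma (real J * \<alpha>) / Gamma \<alpha> ^ J *
              (\<Prod>k<J - 1. x k powr (\<alpha> - 1)) * (1 - (\<Sum>k<J - 1. x k)) powr (\<alpha> - 1)
            else 0)))
       (Pi\<^sub>M {..<J} (\<lambda>_. borel))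
       (\<lambda>x. \<lambda>k\<in>{..<J}. if k = J - 1 then 1 - (\<Sum>l<J - 1. x l) else x k)"

text \<open>A document is the list of its words; its length plays the role of \<open>n\<close>.\<close>

definition doc_mass ::
  "('a, 'b) pre_digraph \<Rightarrow> 'a \<Rightarrow> real \<Rightarrow> ('a, 'v::finite) param \<Rightarrow> 'v list \<Rightarrow> real" where
  "doc_mass T r \<alpha> \<omega> xs =
     (\<Sum>\<phi>\<in>maximal_paths T r. snd \<omega> \<phi> *
       (LINT \<beta>|dirichlet (length \<phi>) \<alpha>.
         (\<Prod>v\<in>UNIV. (\<Sum>k<length \<phi>. \<beta> k * fst \<omega> (\<phi> ! k) $ v) ^ count_list xs v)))"

definition doc_dist ::
  "('a, 'b) pre_digraph \<Rightarrow> 'a \<Rightarrow> real \<Rightarrow> nat \<Rightarrow> ('a, 'v::finite) param \<Rightarrow> 'v list measure" where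
  "doc_dist T r \<alpha> n \<omega> = point_measure {xs. length xs = n} (\<lambda>xs. ennreal (doc_mass T r \<alpha> \<omega> xs))"

section \<open>Posterior contraction\<close>

definition hellinger_dist :: "'x set \<Rightarrow> ('x \<Rightarrow> real) \<Rightarrow> ('x \<Rightarrow> real) \<Rightarrow> real" where
  "hellinger_dist A p q = sqrt (1 / 2 * (\<Sum>x\<in>A. (sqrt (p x) - sqrt (q x))\<^sup>2))"

text \<open>Bayes' formula for \<open>m\<close> i.i.d. observations with probability mass function \<open>p \<omega>\<close>.\<close>

definition posterior ::
  "'w measure \<Rightarrow> ('w \<Rightarrow> 'x \<Rightarrow> real) \<Rightarrow> nat \<Rightarrow> (nat \<Rightarrow> 'x) \<Rightarrow> 'w set \<Rightarrow> real" where
  "posterior M p m X A =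
     (LINT \<omega>:A|M. (\<Prod>j<m. p \<omega> (X j))) / (LINT \<omega>|M. (\<Prod>j<m. p \<omega> (X j)))"

definition hellinger_far ::
  "('a, 'b) pre_digraph \<Rightarrow> 'a \<Rightarrow> real \<Rightarrow> nat \<Rightarrow> ('a, 'v::finite) param \<Rightarrow> real \<Rightarrow> ('a, 'v) param set"
  where
  "hellinger_far T r \<alpha> n \<omega>0 s =
     {\<omega> \<in> topic_params T r.
       hellinger_dist {xs. length xs = n} (doc_mass T r \<alpha> \<omega>0) (doc_mass T r \<alpha> \<omega>) > s}"

text \<open>Convergence to 0 in probability; the probability space may vary along the sequence.\<close>

definition vanishes_in_prob :: "(nat \<Rightarrow> 'x measure) \<Rightarrow> (nat \<Rightarrow> 'x \<Rightarrow> real) \<Rightarrow> bool" where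
  "vanishes_in_prob M Y \<longleftrightarrow>
     (\<forall>\<eta>>0. (\<lambda>k. measure (M k) {x \<in> space (M k). \<eta> < \<bar>Y k x\<bar>}) \<longlonglongrightarrow> 0)"

end

theory Submission
  imports Defs
begin

text \<open>
  Both likelihood bounds come from monotonicity and homogeneity of the document mass in the
  parameters. Within distance of order \<open>1 / (m n)\<close> of the truth the likelihood of \<open>m\<close> documents of
  length \<open>n\<close> is at least a constant times the true likelihood, whatever the data are, and this
  neighbourhood has polynomially small prior mass. Rounding all parameters up to a grid of mesh
  \<open>1 / (n m\<^sup>2)\<close> gives polynomially many upper brackets of size \<open>O(1 / m\<^sup>2)\<close>. The
  Hellinger affinity of such a bracket with the truth is at most \<open>1 - s\<^sup>2 + O(1 / m)\<close> when it meets
  the region at distance more than \<open>s\<close>, so Markov's inequality for the square root of the likelihood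
  ratio and a union bound control the numerator of Bayes' formula by \<open>exp (- m s\<^sup>2)\<close>.
\<close>

text \<open>The obstacle is uniformity in the length n: a fixed perturbation of the topics can
  change likelihoods by factors exponential in n. Since the true parameters are at least
  \<open>c\<close>, an absolute error c / N is a relative error 1 / N. A document mass has degree n
  in the topics and degree 1 in the path weights, so m documents lose at most the factor (1 - 1 /
  N)^(m (n + 1)), which stays bounded below for N = m (n + 1). From above, a mesh 1 / M inflates the
  total mass by a factor 1 + O(n / M). Comparing affinities costs the square root of this excess,
  and m documents multiply the cost by m; so the excess has to be O(1 / m^2), which leads to M = n
  m^2. The number of brackets and the inverse prior mass are then polynomial in m and n, and m s^2 =
  C^2 log max(m, n) beats their logarithms once C is large. Brackets are never normalised: the mass
  formula is evaluated at nonnegative parameters that may lie outside the simplex.\<close>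

section \<open>The Dirichlet distribution\<close>

text \<open>Substituting y = t u reduces this to Euler's Beta integral. The length \<open>t\<close>
  will be the gap that the other coordinates leave below 1.\<close>

lemma nn_integral_Beta_scaled:
  fixes a b t :: real
  assumes "a > 0" "b > 0" "t > 0"
  shows "(\<integral>\<^sup>+y. ennreal (if 0 < y \<and> y < t then y powr (a - 1) * (t - y) powr (b - 1) else 0) \<partial>lborel)
    = ennreal (Beta a b * t powr (a + b - 1))"
proof -
  have "(\<integral>\<^sup>+y. ennreal (if 0 < y \<and> y < t then y powr (a - 1) * (t - y) powr (b - 1) else 0) \<partial>lborel)
     = t * (\<integral>\<^sup>+u. ennreal (if 0 < t * u \<and> t * u < t
               then (t * u) powr (a - 1) * (t - t * u) powr (b - 1) else 0) \<partial>lborel)"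
    using \<open>t > 0\<close> by (subst nn_integral_real_affine[where c = t and t = 0]) (auto cong: if_cong)
  also have "\<dots> = t * (\<integral>\<^sup>+u. ennreal (t powr (a + b - 2)) *
      ennreal (indicator {0..1} u * (u powr (a - 1) * (1 - u) powr (b - 1))) \<partial>lborel)"
  proof (intro arg_cong2[where f = "(*)"] refl nn_integral_cong, goal_cases)
    case (1 u)
    have "(t * u) powr (a - 1) * (t - t * u) powr (b - 1)
        = t powr (a + b - 2) * (u powr (a - 1) * (1 - u) powr (b - 1))" if "0 < u" "u < 1"
    proof -
      have "t - t * u = t * (1 - u)" by (simp add: algebra_simps)
      moreover have "t powr (a + b - 2) = t powr (a - 1) * t powr (b - 1)"
        by (simp flip: powr_add)
      ultimately show ?thesis using that \<open>t > 0\<close> by (simp add: powr_mult)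
    qed
    then show ?case using \<open>t > 0\<close>
      by (auto simp: indicator_def zero_less_mult_iff ennreal_mult'[symmetric])
  qed
  also have "\<dots> = t * (ennreal (t powr (a + b - 2)) * ennreal (Beta a b))"
    using nn_integral_has_integral_lebesgue[OF _ has_integral_Beta_real[OF assms(1,2)]]
    by (subst nn_integral_cmult) auto
  also have "\<dots> = ennreal (Beta a b * (t * t powr (a + b - 2)))"
    using \<open>t > 0\<close> Gamma_real_pos[of a] Gamma_real_pos[of b] Gamma_real_pos[of "a + b"] assms
    by (simp add: ennreal_mult'[symmetric] Beta_def mult_ac)
  also have "t * t powr (a + b - 2) = t powr (a + b - 1)"
    using powr_add[of t 1 "a + b - 2"] \<open>t > 0\<close> by simp
  finally show ?thesis .
qed

text \<open>Integrating out one coordinate raises the exponent of the remaining gap from \<open>b\<close> to \<open>a + b\<close>.\<close>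

lemma nn_integral_Dirichlet:
  fixes a b :: real
  assumes "finite A" "a > 0" "b > 0"
  shows "(\<integral>\<^sup>+x. ennreal (if (\<forall>k\<in>A. 0 < x k) \<and> (\<Sum>k\<in>A. x k) < 1
      then (\<Prod>k\<in>A. x k powr (a - 1)) * (1 - (\<Sum>k\<in>A. x k)) powr (b - 1) else 0)
      \<partial>Pi\<^sub>M A (\<lambda>_. lborel))
    = ennreal (Gamma a ^ card A * Gamma b / Gamma (real (card A) * a + b))"
  using assms(1,3)
proof (induction A arbitrary: b rule: finite_induct)
  case empty
  then show ?case using Gamma_real_pos[OF empty, THEN less_imp_neq]
    by (simp add: PiM_empty nn_integral_count_space_finite)
next
  case (insert i A)
  interpret product_sigma_finite "\<lambda>_. lborel :: real measure" by standard
  let ?d = "\<lambda>A b x. if (\<forall>k\<in>A. 0 < x k) \<and> (\<Sum>k\<in>A. x k) < 1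
      then (\<Prod>k\<in>A. x k powr (a - 1)) * (1 - (\<Sum>k\<in>A. x k)) powr (b - 1) else 0"
  have meas: "(\<lambda>x. ennreal (?d A b x)) \<in> borel_measurable (Pi\<^sub>M A (\<lambda>_. lborel))"
    if "finite A" for A :: "'a set" and b using that by measurable
  have inner: "(\<integral>\<^sup>+y. ennreal (?d (insert i A) b (x(i := y))) \<partial>lborel)
      = ennreal (Beta a b) * ennreal (?d A (a + b) x)" for x
  proof (cases "(\<forall>k\<in>A. 0 < x k) \<and> (\<Sum>k\<in>A. x k) < 1")
    case True
    define t where "t = 1 - (\<Sum>k\<in>A. x k)"
    define P where "P = (\<Prod>k\<in>A. x k powr (a - 1))"
    have "t > 0" using True by (simp add: t_def)
    have "P \<ge> 0" unfolding P_def by (intro prod_nonneg) auto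
    have s: "(\<Sum>k\<in>A. if k = i then y else x k) = (\<Sum>k\<in>A. x k)" for y
      using insert.hyps by (intro sum.cong) auto
    have p: "(\<Prod>k\<in>A. (if k = i then y else x k) powr (a - 1)) = P" for y
      unfolding P_def using insert.hyps by (intro prod.cong) auto
    have "?d (insert i A) b (x(i := y))
       = P * (if 0 < y \<and> y < t then y powr (a - 1) * (t - y) powr (b - 1) else 0)" for y
      using insert.hyps True by (auto simp: s p t_def algebra_simps)
    then have "(\<integral>\<^sup>+y. ennreal (?d (insert i A) b (x(i := y))) \<partial>lborel) =
      (\<integral>\<^sup>+y. ennreal P * ennreal (if 0 < y \<and> y < t then y powr (a - 1) * (t - y) powr (b - 1) else 0) \<partial>lborel)"
      using \<open>P \<ge> 0\<close> by (simp add: ennreal_mult' del: fun_upd_apply)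
    also have "\<dots> = ennreal P * ennreal (Beta a b * t powr (a + b - 1))"
      using nn_integral_Beta_scaled[of a b t] \<open>a > 0\<close> insert.prems \<open>t > 0\<close>
      by (subst nn_integral_cmult) auto
    also have "\<dots> = ennreal (Beta a b) * ennreal (?d A (a + b) x)"
      using True \<open>P \<ge> 0\<close> Gamma_real_pos[of a] Gamma_real_pos[of b] Gamma_real_pos[of "a + b"]
        insert.prems \<open>a > 0\<close>
      by (simp add: P_def[symmetric] t_def[symmetric] ennreal_mult'[symmetric] Beta_def mult_ac)
    finally show ?thesis .
  next
    case False
    have "?d (insert i A) b (x(i := y)) = 0" for y
    proof -
      have "(\<Sum>k\<in>A. if k = i then y else x k) = (\<Sum>k\<in>A. x k)"
        using insert.hyps by (intro sum.cong) auto
      then show ?thesis using False insert.hyps by (auto split: if_splits)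
    qed
    then show ?thesis using False by (auto simp del: fun_upd_apply)
  qed
  have "(\<integral>\<^sup>+x. ennreal (?d (insert i A) b x) \<partial>Pi\<^sub>M (insert i A) (\<lambda>_. lborel))
     = (\<integral>\<^sup>+x. ennreal (Beta a b) * ennreal (?d A (a + b) x) \<partial>Pi\<^sub>M A (\<lambda>_. lborel))"
    by (subst product_nn_integral_insert[OF insert.hyps meas])
      (simp_all only: inner insert.hyps finite_insert)
  also have "\<dots> = ennreal (Beta a b) *
      ennreal (Gamma a ^ card A * Gamma (a + b) / Gamma (real (card A) * a + (a + b)))"
    using insert.IH[of "a + b"] insert.prems \<open>a > 0\<close> insert.hyps meas[of A "a + b"]
    by (subst nn_integral_cmult) auto
  also have "\<dots> = ennreal (Gamma a ^ card (insert i A) * Gamma b / Gamma (real (card (insert i A)) * a + b))"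
    using insert.hyps insert.prems \<open>a > 0\<close> Gamma_real_pos[OF add_pos_pos[OF \<open>a > 0\<close> insert.prems], THEN less_imp_neq]
    by (simp add: ennreal_mult'[symmetric] Beta_def field_simps)
  finally show ?case .
qed

lemma sets_dirichlet [measurable_cong]:
  "sets (dirichlet J \<alpha>) = sets (Pi\<^sub>M {..<J} (\<lambda>_. borel))"
  by (simp add: dirichlet_def)

lemma dirichlet_measurable [measurable]:
  fixes J :: nat
  shows "(\<lambda>x. \<lambda>k\<in>{..<J}. if k = J - 1 then 1 - (\<Sum>l<J - 1. x l) else x k)
     \<in> measurable (Pi\<^sub>M {..<J - 1} (\<lambda>_. lborel)) (Pi\<^sub>M {..<J} (\<lambda>_. borel :: real measure))"
proof (rule measurable_restrict)
  fix k assume "k \<in> {..<J}"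
  show "(\<lambda>x. if k = J - 1 then 1 - (\<Sum>l<J - 1. x l) else x k)
      \<in> measurable (Pi\<^sub>M {..<J - 1} (\<lambda>_. lborel)) (borel :: real measure)"
  proof (cases "k = J - 1")
    case False
    then have "k < J - 1" using \<open>k \<in> {..<J}\<close> by simp
    then show ?thesis using False by simp
  qed simp
qed

lemma prob_space_dirichlet:
  assumes "J > 0" "\<alpha> > 0"
  shows "prob_space (dirichlet J \<alpha>)"
proof -
  let ?c = "Gamma (real J * \<alpha>) / Gamma \<alpha> ^ J"
  let ?d = "\<lambda>x. if (\<forall>k<J - 1. 0 < x k) \<and> (\<Sum>k<J - 1. x k) < 1
      then (\<Prod>k<J - 1. x k powr (\<alpha> - 1)) * (1 - (\<Sum>k<J - 1. x k)) powr (\<alpha> - 1) else 0"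
  have G: "Gamma \<alpha> > 0" "Gamma (real J * \<alpha>) > 0"
    using assms by (simp_all add: Gamma_real_pos)
  then have c: "?c \<ge> 0" by simp
  \<comment> \<open>The J - 1 free coordinates and the gap share one exponent, which is the case a =
    b = \<alpha> of the integral; J > 0 makes \<open>J - 1\<close> a genuine predecessor.\<close>
  have "real (J - 1) * \<alpha> + \<alpha> = real J * \<alpha>" "Gamma \<alpha> ^ (J - 1) * Gamma \<alpha> = Gamma \<alpha> ^ J"
    using assms by (cases J; simp add: algebra_simps)+
  then have "(\<integral>\<^sup>+x. ennreal (?d x) \<partial>Pi\<^sub>M {..<J - 1} (\<lambda>_. lborel))
      = ennreal (Gamma \<alpha> ^ J / Gamma (real J * \<alpha>))"
    using nn_integral_Dirichlet[of "{..<J - 1}" \<alpha> \<alpha>] assms by (simp add: Ball_def)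
  then have "(\<integral>\<^sup>+x. ennreal ?c * ennreal (?d x) \<partial>Pi\<^sub>M {..<J - 1} (\<lambda>_. lborel)) = 1"
    using G c by (subst nn_integral_cmult) (auto simp: ennreal_mult'[symmetric])
  also have "(\<lambda>x. ennreal ?c * ennreal (?d x)) = (\<lambda>x. ennreal
           (if (\<forall>k<J - 1. 0 < x k) \<and> (\<Sum>k<J - 1. x k) < 1
            then Gamma (real J * \<alpha>) / Gamma \<alpha> ^ J *
              (\<Prod>k<J - 1. x k powr (\<alpha> - 1)) * (1 - (\<Sum>k<J - 1. x k)) powr (\<alpha> - 1)
            else 0))"
    using c by (auto simp: fun_eq_iff ennreal_mult'[symmetric] mult_ac)
  finally have "prob_space (density (Pi\<^sub>M {..<J - 1} (\<lambda>_. lborel))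
      (\<lambda>x. ennreal
           (if (\<forall>k<J - 1. 0 < x k) \<and> (\<Sum>k<J - 1. x k) < 1
            then Gamma (real J * \<alpha>) / Gamma \<alpha> ^ J *
              (\<Prod>k<J - 1. x k powr (\<alpha> - 1)) * (1 - (\<Sum>k<J - 1. x k)) powr (\<alpha> - 1)
            else 0)))"
    by (intro prob_spaceI)
      (subst emeasure_density, simp_all cong: if_cong nn_integral_cong_simp add: space_PiM)
  then show ?thesis unfolding dirichlet_def
    by (rule prob_space.prob_space_distr) (subst measurable_cong_sets[OF sets_density refl], rule dirichlet_measurable)
qed

text \<open>The last coordinate is 1 minus the sum of the others, so the total is always 1.
  Nonnegativity is only an almost sure property: the density vanishes off the open simplex, but the
  push-forward map lives on the whole space.\<close>

lemma AE_dirichlet: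
  assumes "J > 0"
  shows "AE \<beta> in dirichlet J \<alpha>. (\<forall>k<J. 0 \<le> \<beta> k) \<and> (\<Sum>k<J. \<beta> k) = 1"
proof -
  obtain d where d: "J = Suc d" using assms by (cases J) auto
  let ?h = "\<lambda>x. \<lambda>k\<in>{..<Suc d}. if k = d then 1 - (\<Sum>l<d. x l) else x k :: real"
  have [measurable]: "?h \<in> measurable (Pi\<^sub>M {..<d} (\<lambda>_. lborel)) (Pi\<^sub>M {..<Suc d} (\<lambda>_. borel))"
    using dirichlet_measurable[of J] by (simp add: d cong: if_cong)
  have sum: "(\<Sum>k<Suc d. ?h x k) = 1" for x by simp
  have "AE x in density (Pi\<^sub>M {..<d} (\<lambda>_. lborel)) (\<lambda>x. ennreal
           (if (\<forall>k<d. 0 < x k) \<and> (\<Sum>k<d. x k) < 1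
            then Gamma (real J * \<alpha>) / Gamma \<alpha> ^ J *
              (\<Prod>k<d. x k powr (\<alpha> - 1)) * (1 - (\<Sum>k<d. x k)) powr (\<alpha> - 1)
            else 0)). (\<forall>k<J. 0 \<le> ?h x k) \<and> (\<Sum>k<J. ?h x k) = 1"
    by (subst AE_density) (auto simp: d less_Suc_eq less_imp_le intro!: AE_I2 split: if_splits)
  then show ?thesis unfolding dirichlet_def d diff_Suc_1
    by (subst AE_distr_iff) simp_all
qed

section \<open>Mass of a document along one path\<close>

text \<open>Passes from counts per word to a product over positions, the form in which a sum over
  all documents factorises.\<close>

lemma prod_power_count_list:
  fixes a :: "'v::finite \<Rightarrow> 'c::comm_monoid_mult"
  shows "(\<Prod>v\<in>UNIV. a v ^ count_list xs v) = prod_list (map a xs)"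
proof (induction xs)
  case (Cons x xs)
  have "(\<Prod>v\<in>UNIV. a v ^ count_list (x # xs) v)
      = (\<Prod>v\<in>UNIV. (if v = x then a v else 1) * a v ^ count_list xs v)"
    by (intro prod.cong) auto
  then show ?case by (simp add: prod.distrib Cons.IH)
qed simp

lemma finite_lists_length [simp]: "finite {xs :: 'v::finite list. length xs = n}"
  using finite_lists_length_eq[of "UNIV :: 'v set" n] by simp

text \<open>Expanding the n-th power gives one term per document of length n; the induction splits
  off the first word.\<close>

lemma sum_prod_list:
  fixes a :: "'v::finite \<Rightarrow> 'c::comm_semiring_1"
  shows "(\<Sum>xs | length xs = n. prod_list (map a xs)) = (\<Sum>v\<in>UNIV. a v) ^ n"
proof (induction n)
  case (Suc n)
  have "(\<Sum>xs | length xs = Suc n. prod_list (map a xs))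
      = (\<Sum>(v, xs)\<in>UNIV \<times> {xs. length xs = n}. a v * prod_list (map a xs))"
    by (rule sum.reindex_bij_witness[of _ "\<lambda>(v, xs). v # xs" "\<lambda>xs. (hd xs, tl xs)"])
      (auto simp: length_Suc_conv)
  also have "\<dots> = (\<Sum>v\<in>UNIV. a v) ^ Suc n"
    by (simp add: sum.cartesian_product[symmetric] sum_product[symmetric] Suc.IH)
  finally show ?case .
qed simp

text \<open>Topics are arbitrary vectors indexed by the position on the path, not points of the
  simplex, since shrunken and rounded-up topics are inserted as well.\<close>

definition path_mass :: "real \<Rightarrow> nat \<Rightarrow> (nat \<Rightarrow> real ^ 'v::finite) \<Rightarrow> 'v list \<Rightarrow> real" where
  "path_mass \<alpha> J \<theta> xs =
     (LINT \<beta>|dirichlet J \<alpha>. (\<Prod>v\<in>UNIV. (\<Sum>k<J. \<beta> k * \<theta> k $ v) ^ count_list xs v))"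

lemma doc_mass_eq_path_mass:
  "doc_mass T r \<alpha> \<omega> xs = (\<Sum>\<phi>\<in>maximal_paths T r.
     snd \<omega> \<phi> * path_mass \<alpha> (length \<phi>) (\<lambda>k. fst \<omega> (\<phi> ! k)) xs)"
  by (simp add: doc_mass_def path_mass_def)

context
  fixes J :: nat and \<alpha> :: real
  assumes J: "J > 0" and \<alpha>: "\<alpha> > 0"
begin

interpretation dir: prob_space "dirichlet J \<alpha>"
  using prob_space_dirichlet[OF J \<alpha>] .

lemma dirichlet_component_measurable [measurable]:
  "k < J \<Longrightarrow> (\<lambda>\<beta>. \<beta> k) \<in> borel_measurable (dirichlet J \<alpha>)"
  by (subst measurable_cong_sets[OF sets_dirichlet refl]) simp

text \<open>Almost surely the weights lie between 0 and 1. The last bound is free of \<beta> and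
  serves as the dominating constant for integrability.\<close>

lemma AE_mixture_bounds:
  assumes "\<And>k. k < J \<Longrightarrow> 0 \<le> a k" "\<And>k. k < J \<Longrightarrow> a k \<le> b k"
  shows "AE \<beta> in dirichlet J \<alpha>. 0 \<le> (\<Sum>k<J. \<beta> k * a k) \<and>
    (\<Sum>k<J. \<beta> k * a k) \<le> (\<Sum>k<J. \<beta> k * b k) \<and> (\<Sum>k<J. \<beta> k * a k) \<le> (\<Sum>k<J. a k)"
  using AE_dirichlet[OF J]
proof eventually_elim
  case (elim \<beta>)
  then have "\<beta> k \<le> 1" if "k < J" for k
    using member_le_sum[of k "{..<J}" \<beta>] that by auto
  with elim assms show ?case
    by (auto intro!: sum_nonneg sum_mono mult_left_mono mult_left_le_one_le)
qed

lemma integrable_path_integrand: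
  assumes "\<And>k v. k < J \<Longrightarrow> 0 \<le> \<theta> k $ v"
  shows "integrable (dirichlet J \<alpha>)
    (\<lambda>\<beta>. \<Prod>v\<in>UNIV. (\<Sum>k<J. \<beta> k * \<theta> k $ (v::'v::finite)) ^ count_list xs v)"
proof (rule dir.integrable_const_bound[where B = "\<Prod>v\<in>UNIV. (\<Sum>k<J. \<theta> k $ v) ^ count_list xs v"])
  have "AE \<beta> in dirichlet J \<alpha>. \<forall>v. 0 \<le> (\<Sum>k<J. \<beta> k * \<theta> k $ v) \<and>
      (\<Sum>k<J. \<beta> k * \<theta> k $ v) \<le> (\<Sum>k<J. \<theta> k $ v)"
    using AE_mixture_bounds[of "\<lambda>k. \<theta> k $ v" "\<lambda>k. \<theta> k $ v" for v] assms
    by (subst AE_all_countable) fastforce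
  then show "AE \<beta> in dirichlet J \<alpha>. norm (\<Prod>v\<in>UNIV. (\<Sum>k<J. \<beta> k * \<theta> k $ v) ^ count_list xs v)
      \<le> (\<Prod>v\<in>UNIV. (\<Sum>k<J. \<theta> k $ v) ^ count_list xs v)"
    by eventually_elim (auto simp: abs_prod power_abs intro!: prod_mono power_mono)
qed measurable

lemma path_mass_mono:
  fixes \<theta> \<theta>' :: "nat \<Rightarrow> real ^ 'v::finite"
  assumes "\<And>k v. k < J \<Longrightarrow> 0 \<le> \<theta> k $ v" "\<And>k v. k < J \<Longrightarrow> \<theta> k $ v \<le> \<theta>' k $ v"
  shows "path_mass \<alpha> J \<theta> xs \<le> path_mass \<alpha> J \<theta>' xs"
  unfolding path_mass_def
proof (rule integral_mono_AE)
  have "AE \<beta> in dirichlet J \<alpha>. \<forall>v. 0 \<le> (\<Sum>k<J. \<beta> k * \<theta> k $ v) \<and>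
      (\<Sum>k<J. \<beta> k * \<theta> k $ v) \<le> (\<Sum>k<J. \<beta> k * \<theta>' k $ v)"
    using AE_mixture_bounds[of "\<lambda>k. \<theta> k $ v" "\<lambda>k. \<theta>' k $ v" for v] assms
    by (subst AE_all_countable) fastforce
  then show "AE \<beta> in dirichlet J \<alpha>. (\<Prod>v\<in>UNIV. (\<Sum>k<J. \<beta> k * \<theta> k $ v) ^ count_list xs v)
      \<le> (\<Prod>v\<in>UNIV. (\<Sum>k<J. \<beta> k * \<theta>' k $ v) ^ count_list xs v)"
    by eventually_elim (auto intro!: prod_mono power_mono)
qed (rule integrable_path_integrand, use assms order_trans in blast)+

lemma path_mass_nonneg:
  fixes \<theta> :: "nat \<Rightarrow> real ^ 'v::finite"
  assumes "\<And>k v. k < J \<Longrightarrow> 0 \<le> \<theta> k $ v"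
  shows "0 \<le> path_mass \<alpha> J \<theta> xs"
proof -
  have "AE \<beta> in dirichlet J \<alpha>. \<forall>v. 0 \<le> (\<Sum>k<J. \<beta> k * \<theta> k $ v)"
    using AE_mixture_bounds[of "\<lambda>k. \<theta> k $ v" "\<lambda>k. \<theta> k $ v" for v] assms
    by (subst AE_all_countable) fastforce
  then have "AE \<beta> in dirichlet J \<alpha>. 0 \<le> (\<Prod>v\<in>UNIV. (\<Sum>k<J. \<beta> k * \<theta> k $ v) ^ count_list xs v)"
    by eventually_elim (auto intro!: prod_nonneg)
  then show ?thesis unfolding path_mass_def by (rule integral_nonneg_AE)
qed

text \<open>The exponents \<open>count_list xs v\<close> add up to \<open>length xs\<close>, so the
  integrand is homogeneous of that degree in the topics.\<close>

lemma path_mass_scale: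
  fixes \<theta> :: "nat \<Rightarrow> real ^ 'v::finite"
  shows "path_mass \<alpha> J (\<lambda>k. c *\<^sub>R \<theta> k) xs = c ^ length xs * path_mass \<alpha> J \<theta> xs"
proof -
  have "(\<Prod>v\<in>UNIV. (\<Sum>k<J. \<beta> k * (c *\<^sub>R \<theta> k) $ v) ^ count_list xs v)
      = c ^ length xs * (\<Prod>v\<in>UNIV. (\<Sum>k<J. \<beta> k * \<theta> k $ v) ^ count_list xs v)" for \<beta> :: "nat \<Rightarrow> real"
  proof -
    have "(\<Sum>k<J. \<beta> k * (c *\<^sub>R \<theta> k) $ v) = c * (\<Sum>k<J. \<beta> k * \<theta> k $ v)" for v
      by (simp add: sum_distrib_left mult_ac)
    moreover have "(\<Prod>v\<in>UNIV. c ^ count_list xs v) = c ^ length xs"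
      by (simp add: prod_power_count_list map_replicate_const)
    ultimately show ?thesis by (simp add: power_mult_distrib prod.distrib)
  qed
  then show ?thesis by (simp add: path_mass_def)
qed

text \<open>For fixed \<beta> the sum over documents is the n-th power of the total mass of the
  mixture. With unnormalised topics this serves both the exact total 1 of a model and the upper
  bound for a bracket.\<close>

lemma sum_path_mass:
  fixes \<theta> :: "nat \<Rightarrow> real ^ 'v::finite"
  assumes "\<And>k v. k < J \<Longrightarrow> 0 \<le> \<theta> k $ v"
  shows "(\<Sum>xs | length xs = n. path_mass \<alpha> J \<theta> xs)
    = (LINT \<beta>|dirichlet J \<alpha>. (\<Sum>k<J. \<beta> k * (\<Sum>v\<in>UNIV. \<theta> k $ v)) ^ n)"
proof -
  have "(\<Sum>v\<in>UNIV. \<Sum>k<J. \<beta> k * \<theta> k $ v) = (\<Sum>k<J. \<beta> k * (\<Sum>v\<in>UNIV. \<theta> k $ v))" for \<beta> :: "nat \<Rightarrow> real"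
    by (subst sum.swap) (simp add: sum_distrib_left)
  then show ?thesis unfolding path_mass_def
    using integrable_path_integrand[of \<theta>] assms
    by (subst Bochner_Integration.integral_sum[symmetric])
      (simp_all add: prod_power_count_list sum_prod_list)
qed

lemma sum_path_mass_eq_1:
  fixes \<theta> :: "nat \<Rightarrow> real ^ 'v::finite"
  assumes "\<And>k v. k < J \<Longrightarrow> 0 \<le> \<theta> k $ v" "\<And>k. k < J \<Longrightarrow> (\<Sum>v\<in>UNIV. \<theta> k $ v) = 1"
  shows "(\<Sum>xs | length xs = n. path_mass \<alpha> J \<theta> xs) = 1"
proof -
  have "AE \<beta> in dirichlet J \<alpha>. (\<Sum>k<J. \<beta> k * (\<Sum>v\<in>UNIV. \<theta> k $ v)) ^ n = 1"
    using AE_dirichlet[OF J] by eventually_elim (simp add: assms)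
  then have "(LINT \<beta>|dirichlet J \<alpha>. (\<Sum>k<J. \<beta> k * (\<Sum>v\<in>UNIV. \<theta> k $ v)) ^ n)
      = (LINT \<beta>|dirichlet J \<alpha>. 1)"
    by (intro integral_cong_AE) measurable
  then show ?thesis using assms by (simp add: sum_path_mass dir.prob_space)
qed

lemma sum_path_mass_le:
  fixes \<theta> :: "nat \<Rightarrow> real ^ 'v::finite"
  assumes "\<And>k v. k < J \<Longrightarrow> 0 \<le> \<theta> k $ v" "\<And>k. k < J \<Longrightarrow> (\<Sum>v\<in>UNIV. \<theta> k $ v) \<le> B"
  shows "(\<Sum>xs | length xs = n. path_mass \<alpha> J \<theta> xs) \<le> B ^ n"
proof -
  let ?s = "\<lambda>k. \<Sum>v\<in>UNIV. \<theta> k $ v"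
  have "AE \<beta> in dirichlet J \<alpha>. 0 \<le> (\<Sum>k<J. \<beta> k * ?s k) ^ n \<and> (\<Sum>k<J. \<beta> k * ?s k) ^ n \<le> B ^ n"
    using AE_dirichlet[OF J]
  proof eventually_elim
    case (elim \<beta>)
    have nonneg: "0 \<le> (\<Sum>k<J. \<beta> k * ?s k)"
      using elim assms by (intro sum_nonneg mult_nonneg_nonneg) auto
    have "(\<Sum>k<J. \<beta> k * ?s k) \<le> (\<Sum>k<J. \<beta> k * B)"
      using elim assms by (intro sum_mono mult_left_mono) auto
    also have "\<dots> = B" using elim by (simp flip: sum_distrib_right)
    finally show ?case using nonneg by (simp add: power_mono)
  qed
  moreover have "0 \<le> B"
    using order_trans[OF sum_nonneg[of UNIV "\<lambda>v. \<theta> 0 $ v"] assms(2)[OF J]] assms(1)[OF J] by simp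
  ultimately have "(LINT \<beta>|dirichlet J \<alpha>. (\<Sum>k<J. \<beta> k * ?s k) ^ n) \<le> (LINT \<beta>|dirichlet J \<alpha>. B ^ n)"
    by (intro integral_mono_AE dir.integrable_const_bound[where B = "B ^ n"]) auto
  then show ?thesis using assms by (simp add: sum_path_mass dir.prob_space)
qed

text \<open>An integral over the probability space of \<beta> is measurable in the remaining
  variable when the integrand is jointly measurable. This makes likelihoods integrable against the
  prior.\<close>

lemma path_mass_measurable:
  assumes [measurable]: "\<And>k v. k < J \<Longrightarrow> (\<lambda>w. \<theta> w k $ v) \<in> borel_measurable M"
  shows "(\<lambda>w. path_mass \<alpha> J (\<theta> w :: nat \<Rightarrow> real ^ 'v::finite) xs) \<in> borel_measurable M"
  unfolding path_mass_def by measurable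

end

section \<open>A posterior tail bound from upper brackets\<close>

lemma real_sqrt_prod: "sqrt (prod f A) = (\<Prod>x\<in>A. sqrt (f x))"
  by (induction A rule: infinite_finite_induct) (auto simp: real_sqrt_mult)

text \<open>For positive \<open>q\<close> the affinity is the q-expectation of sqrt (p / q), and
  expectations multiply over independent observations. Expanding the square brings the Hellinger
  distance into this form.\<close>

lemma hellinger_affinity:
  assumes "\<And>x. x \<in> A \<Longrightarrow> 0 \<le> p x" "\<And>x. x \<in> A \<Longrightarrow> 0 \<le> q x"
    and "sum p A = 1" "sum q A = 1"
  shows "(\<Sum>x\<in>A. sqrt (p x * q x)) = 1 - (hellinger_dist A p q)\<^sup>2"
proof -
  have "(hellinger_dist A p q)\<^sup>2 = 1 / 2 * (\<Sum>x\<in>A. (sqrt (p x) - sqrt (q x))\<^sup>2)"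
    by (simp add: hellinger_dist_def sum_nonneg)
  also have "(\<Sum>x\<in>A. (sqrt (p x) - sqrt (q x))\<^sup>2) = (\<Sum>x\<in>A. p x + q x - 2 * sqrt (p x * q x))"
    using assms(1,2) by (intro sum.cong) (auto simp: power2_diff real_sqrt_mult)
  also have "\<dots> = 2 - 2 * (\<Sum>x\<in>A. sqrt (p x * q x))"
    by (simp add: sum.distrib sum_subtractf assms(3,4) flip: sum_distrib_left)
  finally show ?thesis by simp
qed

text \<open>From sqrt g \<le> sqrt p + sqrt (g - p): Cauchy-Schwarz against the unit vector sqrt q
  turns the excess mass \<gamma> into the cost sqrt \<gamma>.\<close>

lemma affinity_le_of_bracket:
  assumes "\<And>x. x \<in> A \<Longrightarrow> 0 \<le> p x" "\<And>x. x \<in> A \<Longrightarrow> p x \<le> g x" "\<And>x. x \<in> A \<Longrightarrow> 0 \<le> q x"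
    and "sum q A = 1" "(\<Sum>x\<in>A. g x - p x) \<le> \<gamma>"
  shows "(\<Sum>x\<in>A. sqrt (g x * q x)) \<le> (\<Sum>x\<in>A. sqrt (p x * q x)) + sqrt \<gamma>"
proof -
  have "(\<Sum>x\<in>A. sqrt (g x - p x) * sqrt (q x))\<^sup>2 \<le> (\<Sum>x\<in>A. (sqrt (g x - p x))\<^sup>2) * (\<Sum>x\<in>A. (sqrt (q x))\<^sup>2)"
    by (rule Cauchy_Schwarz_ineq_sum)
  also have "\<dots> = (\<Sum>x\<in>A. g x - p x)"
    using assms by simp
  finally have CS: "(\<Sum>x\<in>A. sqrt (g x - p x) * sqrt (q x)) \<le> sqrt \<gamma>"
    using assms(5) by (intro real_le_rsqrt) simp
  have "(\<Sum>x\<in>A. sqrt (g x * q x)) \<le> (\<Sum>x\<in>A. sqrt (p x * q x) + sqrt (g x - p x) * sqrt (q x))"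
  proof (rule sum_mono)
    fix x assume "x \<in> A"
    then have "sqrt (g x) \<le> sqrt (p x) + sqrt (g x - p x)"
      using sqrt_add_le_add_sqrt[of "p x" "g x - p x"] assms by simp
    then have "sqrt (g x) * sqrt (q x) \<le> (sqrt (p x) + sqrt (g x - p x)) * sqrt (q x)"
      using assms \<open>x \<in> A\<close> by (intro mult_right_mono) auto
    then show "sqrt (g x * q x) \<le> sqrt (p x * q x) + sqrt (g x - p x) * sqrt (q x)"
      by (simp add: real_sqrt_mult algebra_simps)
  qed
  then show ?thesis using CS by (simp add: sum.distrib)
qed

text \<open>The integrand sees only the first m observations, so the infinite product projects to a
  finite one, where Tonelli's theorem factorises the integral.\<close>

lemma nn_integral_iid_prod:
  assumes "finite A" "\<And>x. x \<in> A \<Longrightarrow> 0 \<le> p x" "sum p A = 1" "\<And>x. x \<in> A \<Longrightarrow> 0 \<le> f x"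
  shows "(\<integral>\<^sup>+X. (\<Prod>j<m. ennreal (f (X j))) \<partial>Pi\<^sub>M (UNIV :: nat set) (\<lambda>_. point_measure A (\<lambda>x. ennreal (p x))))
    = ennreal ((\<Sum>x\<in>A. p x * f x) ^ m)"
proof -
  let ?D = "\<lambda>_ :: nat. point_measure A (\<lambda>x. ennreal (p x))"
  interpret D: prob_space "?D i" for i
    using assms by (intro prob_space_point_measure) auto
  interpret product_prob_space ?D UNIV by standard
  have [measurable]: "h \<in> borel_measurable (point_measure A w)" for h :: "'a \<Rightarrow> ennreal" and w
    by (simp add: measurable_def space_point_measure sets_point_measure)
  have "(\<integral>\<^sup>+X. (\<Prod>j<m. ennreal (f (X j))) \<partial>Pi\<^sub>M UNIV ?D)
      = (\<integral>\<^sup>+X. (\<Prod>j<m. ennreal (f (X j))) \<partial>distr (Pi\<^sub>M UNIV ?D) (Pi\<^sub>M {..<m} ?D) (\<lambda>x. restrict x {..<m}))"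
    by (subst nn_integral_distr) (auto intro!: nn_integral_cong prod.cong measurable_restrict_subset)
  also have "distr (Pi\<^sub>M UNIV ?D) (Pi\<^sub>M {..<m} ?D) (\<lambda>x. restrict x {..<m}) = Pi\<^sub>M {..<m} ?D"
    by (rule distr_PiM_restrict_finite) auto
  also have "(\<integral>\<^sup>+X. (\<Prod>j<m. ennreal (f (X j))) \<partial>Pi\<^sub>M {..<m} ?D) = (\<Prod>j<m. integral\<^sup>N (?D j) (\<lambda>x. ennreal (f x)))"
    by (rule product_nn_integral_prod) auto
  also have "integral\<^sup>N (?D j) (\<lambda>x. ennreal (f x)) = ennreal (\<Sum>x\<in>A. p x * f x)" for j
    using assms by (simp add: nn_integral_point_measure_finite ennreal_mult'[symmetric] sum_ennreal)
  finally show ?thesis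
    using assms by (simp add: ennreal_power sum_nonneg)
qed

text \<open>Chernoff bound with exponent 1/2: the p-expectation of sqrt (g / p) is exactly the
  affinity of \<open>g\<close> and \<open>p\<close>, which makes sense also for a bracket
  \<open>g\<close> of total mass above 1.\<close>

lemma likelihood_ratio_tail:
  fixes A :: "'x set" and p g :: "'x \<Rightarrow> real" and t :: real and m :: nat
  assumes "finite A" "\<And>x. x \<in> A \<Longrightarrow> 0 < p x" "sum p A = 1" "\<And>x. x \<in> A \<Longrightarrow> 0 \<le> g x"
  defines "P \<equiv> Pi\<^sub>M (UNIV :: nat set) (\<lambda>_. point_measure A (\<lambda>x. ennreal (p x)))"
  defines "E \<equiv> {X \<in> space P. exp (- t) * (\<Prod>j<m. p (X j)) \<le> (\<Prod>j<m. g (X j))}"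
  shows "E \<in> sets P" "measure P E \<le> exp (t / 2) * (\<Sum>x\<in>A. sqrt (g x * p x)) ^ m"
proof -
  interpret P: prob_space P unfolding P_def
    using assms(1-3) by (intro prob_space_PiM prob_space_point_measure) (auto simp: sum_ennreal less_imp_le)
  have [measurable]: "h \<in> borel_measurable (point_measure A w)" for h :: "'x \<Rightarrow> real" and w
    by (simp add: measurable_def space_point_measure sets_point_measure)
  show [measurable]: "E \<in> sets P" unfolding E_def P_def by measurable
  define f where "f x = sqrt (g x / p x)" for x
  have in_A: "X j \<in> A" if "X \<in> space P" for X j
    using that by (auto simp: P_def space_PiM space_point_measure)
  have "emeasure P E \<le> emeasure P {X \<in> space P. 1 \<le> ennreal (exp (t / 2)) * (\<Prod>j<m. ennreal (f (X j)))}"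
  proof (rule emeasure_mono)
    show "E \<subseteq> {X \<in> space P. 1 \<le> ennreal (exp (t / 2)) * (\<Prod>j<m. ennreal (f (X j)))}"
    proof safe
      fix X assume "X \<in> E"
      then have X: "X \<in> space P" and le: "exp (- t) * (\<Prod>j<m. p (X j)) \<le> (\<Prod>j<m. g (X j))"
        by (auto simp: E_def)
      have pos: "(\<Prod>j<m. p (X j)) > 0"
        using in_A[OF X] assms(2) by (intro prod_pos) auto
      have fn: "f (X j) \<ge> 0" for j
        using in_A[OF X, of j] assms(2)[of "X j"] assms(4)[of "X j"] by (simp add: f_def)
      have "exp (- t) \<le> (\<Prod>j<m. g (X j)) / (\<Prod>j<m. p (X j))"
        using le pos by (simp add: field_simps)
      then have "sqrt (exp (- t)) \<le> sqrt ((\<Prod>j<m. g (X j)) / (\<Prod>j<m. p (X j)))"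
        by (rule real_sqrt_le_mono)
      also have "\<dots> = (\<Prod>j<m. f (X j))"
        by (simp add: f_def prod_dividef[symmetric] real_sqrt_prod)
      also have "sqrt (exp (- t)) = exp (- t / 2)"
        by (rule real_sqrt_unique) (auto simp: exp_double[symmetric] power2_eq_square simp flip: exp_add)
      finally have "1 \<le> exp (t / 2) * (\<Prod>j<m. f (X j))"
        by (simp add: exp_minus field_simps)
      then show "1 \<le> ennreal (exp (t / 2)) * (\<Prod>j<m. ennreal (f (X j)))"
        using fn by (simp add: prod_ennreal ennreal_mult'[symmetric])
    qed (auto simp: E_def)
    show "{X \<in> space P. 1 \<le> ennreal (exp (t / 2)) * (\<Prod>j<m. ennreal (f (X j)))} \<in> sets P"
      unfolding P_def by measurable
  qed
  also have "\<dots> \<le> ennreal (exp (t / 2)) * (\<integral>\<^sup>+X. (\<Prod>j<m. ennreal (f (X j))) * indicator (space P) X \<partial>P)"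
    by (rule nn_integral_Markov_inequality) (unfold P_def, measurable)
  also have "(\<integral>\<^sup>+X. (\<Prod>j<m. ennreal (f (X j))) * indicator (space P) X \<partial>P) = (\<integral>\<^sup>+X. (\<Prod>j<m. ennreal (f (X j))) \<partial>P)"
    by (intro nn_integral_cong) auto
  also have "\<dots> = ennreal ((\<Sum>x\<in>A. p x * f x) ^ m)"
    unfolding P_def using assms by (intro nn_integral_iid_prod) (auto simp: f_def intro: less_imp_le divide_nonneg_pos)
  also have "(\<Sum>x\<in>A. p x * f x) = (\<Sum>x\<in>A. sqrt (g x * p x))"
  proof (rule sum.cong)
    fix x assume "x \<in> A"
    then have "p x > 0" by (rule assms)
    then show "p x * f x = sqrt (g x * p x)"
      by (simp add: f_def real_sqrt_divide real_sqrt_mult field_simps)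
  qed simp
  finally have "ennreal (measure P E) \<le> ennreal (exp (t / 2) * (\<Sum>x\<in>A. sqrt (g x * p x)) ^ m)"
    by (simp add: P.emeasure_eq_measure ennreal_mult')
  moreover have "0 \<le> (\<Sum>x\<in>A. sqrt (g x * p x))"
    using assms(2,4) by (intro sum_nonneg) (auto intro!: mult_nonneg_nonneg intro: less_imp_le)
  ultimately show "measure P E \<le> exp (t / 2) * (\<Sum>x\<in>A. sqrt (g x * p x)) ^ m"
    by (simp add: ennreal_le_iff)
qed

text \<open>The set \<open>G\<close> consists of upper brackets, \<open>B\<close> of parameters whose likelihood ratio to the truth
  is bounded below deterministically. Therefore only the numerator of Bayes' formula is random.\<close>

lemma posterior_tail_bound:
  fixes M :: "'w measure" and A :: "'x set" and p :: "'w \<Rightarrow> 'x \<Rightarrow> real" and p0 :: "'x \<Rightarrow> real"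
    and G :: "('x \<Rightarrow> real) set" and m :: nat and s :: real
  assumes "prob_space M" "finite A"
    and p0: "\<And>x. x \<in> A \<Longrightarrow> 0 < p0 x" "sum p0 A = 1"
    and p_meas: "\<And>x. x \<in> A \<Longrightarrow> (\<lambda>w. p w x) \<in> borel_measurable M"
    and p: "\<And>w x. w \<in> space M \<Longrightarrow> x \<in> A \<Longrightarrow> 0 \<le> p w x" "\<And>w. w \<in> space M \<Longrightarrow> sum (p w) A = 1"
    and B: "B \<in> sets M" "measure M B > 0" "d > 0" "\<And>w x. w \<in> B \<Longrightarrow> x \<in> A \<Longrightarrow> d * p0 x \<le> p w x"
    and F: "F \<subseteq> space M" "s \<ge> 0" "\<And>w. w \<in> F \<Longrightarrow> s \<le> hellinger_dist A p0 (p w)"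
    and G: "finite G"
      "\<And>w. w \<in> F \<Longrightarrow> \<exists>g\<in>G. (\<forall>x\<in>A. p w x \<le> g x) \<and> (\<Sum>x\<in>A. g x - p w x) \<le> \<gamma>"
    and \<eta>: "exp (- real m * s\<^sup>2) \<le> \<eta> * (d ^ m * measure M B)"
  defines "P \<equiv> Pi\<^sub>M (UNIV :: nat set) (\<lambda>_. point_measure A (\<lambda>x. ennreal (p0 x)))"
  shows "measure P {X \<in> space P. \<eta> < \<bar>posterior M p m X F\<bar>}
    \<le> real (card G) * exp (m * sqrt \<gamma> - m * s\<^sup>2 / 2)"
proof -
  interpret prob_space M by fact
  interpret P: prob_space P unfolding P_def
    using assms(2) p0 by (intro prob_space_PiM prob_space_point_measure) (auto simp: sum_ennreal less_imp_le)
  define t where "t = m * s\<^sup>2"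
  \<comment> \<open>A bracket of no point of \<open>F\<close> may have affinity near 1 with the
    truth, so only brackets with a witness in \<open>F\<close> are kept.\<close>
  define G' where "G' = {g \<in> G. \<exists>w\<in>F. (\<forall>x\<in>A. p w x \<le> g x) \<and> (\<Sum>x\<in>A. g x - p w x) \<le> \<gamma>}"
  define E where "E g = {X \<in> space P. exp (- t) * (\<Prod>j<m. p0 (X j)) \<le> (\<Prod>j<m. g (X j))}" for g
  have "finite G'" "card G' \<le> card G" using G(1) by (auto simp: G'_def intro: card_mono)
  have E: "E g \<in> sets P \<and> measure P (E g) \<le> exp (m * sqrt \<gamma> - m * s\<^sup>2 / 2)" if gG: "g \<in> G'" for g
  proof -
    obtain w where w: "w \<in> F" "\<And>x. x \<in> A \<Longrightarrow> p w x \<le> g x" "(\<Sum>x\<in>A. g x - p w x) \<le> \<gamma>"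
      using gG unfolding G'_def by blast
    have wM: "w \<in> space M" using w F by auto
    have g: "0 \<le> g x" if "x \<in> A" for x
      using p(1)[OF wM that] w(2)[OF that] by simp
    have "s\<^sup>2 \<le> (hellinger_dist A p0 (p w))\<^sup>2"
      using F w by (intro power_mono) auto
    then have "(\<Sum>x\<in>A. sqrt (p w x * p0 x)) \<le> 1 - s\<^sup>2"
      using hellinger_affinity[of A p0 "p w"] p wM p0 by (simp add: less_imp_le mult.commute)
    moreover have "(\<Sum>x\<in>A. sqrt (g x * p0 x)) \<le> (\<Sum>x\<in>A. sqrt (p w x * p0 x)) + sqrt \<gamma>"
      using w wM p p0 by (intro affinity_le_of_bracket) (auto intro: less_imp_le)
    ultimately have "(\<Sum>x\<in>A. sqrt (g x * p0 x)) \<le> 1 + (sqrt \<gamma> - s\<^sup>2)" by simp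
    \<comment> \<open>This holds whatever the sign of the exponent and turns the m-th power into a
      plain exponential.\<close>
    also have "\<dots> \<le> exp (sqrt \<gamma> - s\<^sup>2)" by (rule exp_ge_add_one_self)
    finally have "(\<Sum>x\<in>A. sqrt (g x * p0 x)) ^ m \<le> exp (sqrt \<gamma> - s\<^sup>2) ^ m"
      using g p0 by (intro power_mono sum_nonneg) (auto intro!: mult_nonneg_nonneg intro: less_imp_le)
    then have "exp (t / 2) * (\<Sum>x\<in>A. sqrt (g x * p0 x)) ^ m \<le> exp (t / 2) * exp (m * (sqrt \<gamma> - s\<^sup>2))"
      by (simp add: exp_of_nat_mult)
    also have "\<dots> = exp (m * sqrt \<gamma> - m * s\<^sup>2 / 2)"
      by (simp add: t_def algebra_simps flip: exp_add)
    finally show ?thesis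
      using likelihood_ratio_tail[where g = g and t = t and m = m, OF assms(2) p0 g] unfolding E_def P_def by auto
  qed
  have "{X \<in> space P. \<eta> < \<bar>posterior M p m X F\<bar>} \<subseteq> (\<Union>g\<in>G'. E g)"
  proof (rule ccontr)
    assume "\<not> ?thesis"
    then obtain X where X: "X \<in> space P" "\<eta> < \<bar>posterior M p m X F\<bar>" "\<And>g. g \<in> G' \<Longrightarrow> X \<notin> E g"
      by auto
    have XA: "X j \<in> A" for j
      using X(1) by (auto simp: P_def space_PiM space_point_measure)
    define L0 where "L0 = (\<Prod>j<m. p0 (X j))"
    define L where "L w = (\<Prod>j<m. p w (X j))" for w
    have "L0 > 0" unfolding L0_def using p0 XA by (intro prod_pos) auto
    have [measurable]: "L \<in> borel_measurable M"
      unfolding L_def using p_meas XA by (intro borel_measurable_prod) auto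
    \<comment> \<open>A probability mass is at most 1 at each point; hence the likelihood is bounded
      and integrable under the prior.\<close>
    have L: "0 \<le> L w" "L w \<le> 1" if "w \<in> space M" for w
    proof -
      have "p w x \<le> 1" if "x \<in> A" for x
        using member_le_sum[of x A "p w"] p \<open>w \<in> space M\<close> that assms(2) by auto
      then show "0 \<le> L w" "L w \<le> 1"
        unfolding L_def using p that XA by (auto intro!: prod_nonneg prod_le_1)
    qed
    have int: "integrable M L"
      using L by (intro integrable_const_bound[where B = 1]) auto
    have LF: "L w \<le> exp (- t) * L0" if wF: "w \<in> F" for w
    proof -
      obtain g where g: "g \<in> G'" "\<And>x. x \<in> A \<Longrightarrow> p w x \<le> g x"
        using G(2)[OF wF] wF unfolding G'_def by blast
      have "L w \<le> (\<Prod>j<m. g (X j))"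
        unfolding L_def using g XA p wF F by (intro prod_mono) auto
      also have "\<dots> \<le> exp (- t) * L0"
        using X(3)[OF g(1)] X(1) by (auto simp: E_def L0_def)
      finally show ?thesis .
    qed
    have num: "0 \<le> (LINT w:F|M. L w)" "(LINT w:F|M. L w) \<le> exp (- t) * L0"
    proof -
      show "0 \<le> (LINT w:F|M. L w)"
        unfolding set_lebesgue_integral_def using L by (intro integral_nonneg_AE AE_I2) (auto simp: indicator_def)
      show "(LINT w:F|M. L w) \<le> exp (- t) * L0"
      proof (cases "integrable M (\<lambda>w. indicator F w *\<^sub>R L w)")
        case True
        then show ?thesis unfolding set_lebesgue_integral_def
          using LF \<open>L0 > 0\<close> by (intro integral_le_const AE_I2) (auto simp: indicator_def)
      next
        \<comment> \<open>\<open>F\<close> is an arbitrary subset of the space; should the integrand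
          fail to be integrable, the Bochner integral takes its default value 0.\<close>
        case False
        then show ?thesis unfolding set_lebesgue_integral_def
          using \<open>L0 > 0\<close> by (simp add: not_integrable_integral_eq)
      qed
    qed
    have den: "d ^ m * L0 * measure M B \<le> (LINT w|M. L w)"
    proof -
      have "d ^ m * L0 * measure M B = (LINT w|M. d ^ m * L0 * indicator B w)"
        using B by simp
      also have "\<dots> \<le> (LINT w|M. L w)"
      proof (rule integral_mono)
        fix w assume "w \<in> space M"
        have "d ^ m * L0 \<le> L w" if "w \<in> B"
        proof -
          have "d ^ m * L0 = (\<Prod>j<m. d * p0 (X j))"
            by (simp add: L0_def prod.distrib)
          also have "\<dots> \<le> L w"
            unfolding L_def using B that XA p0 by (intro prod_mono) (auto intro: less_imp_le)
          finally show ?thesis .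
        qed
        then show "d ^ m * L0 * indicator B w \<le> L w"
          using L(1)[OF \<open>w \<in> space M\<close>] by (auto simp: indicator_def)
      next
        have "integrable M (indicator B :: 'w \<Rightarrow> real)"
          using B(1) by (intro integrable_real_indicator) (auto simp: emeasure_eq_measure)
        then show "integrable M (\<lambda>w. d ^ m * L0 * indicator B w)" by simp
      qed (use int in auto)
      finally show ?thesis .
    qed
    have pos: "d ^ m * L0 * measure M B > 0" using B \<open>L0 > 0\<close> by simp
    have "\<bar>posterior M p m X F\<bar> = (LINT w:F|M. L w) / (LINT w|M. L w)"
      unfolding posterior_def L_def[symmetric] using num(1) den pos
      by (intro abs_of_nonneg divide_nonneg_nonneg) linarith+
    also have "\<dots> \<le> exp (- t) * L0 / (d ^ m * L0 * measure M B)"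
      using \<open>L0 > 0\<close> by (intro frac_le num den pos) simp
    \<comment> \<open>The true likelihood cancels, and what remains is free of the data.\<close>
    also have "\<dots> \<le> \<eta>"
      using \<eta> B \<open>L0 > 0\<close> by (simp add: t_def divide_le_eq mult_ac)
    finally show False using X(2) by simp
  qed
  then have "measure P {X \<in> space P. \<eta> < \<bar>posterior M p m X F\<bar>} \<le> measure P (\<Union>g\<in>G'. E g)"
    using E \<open>finite G'\<close> by (intro P.finite_measure_mono) auto
  also have "\<dots> \<le> (\<Sum>g\<in>G'. measure P (E g))"
    using E \<open>finite G'\<close> by (intro measure_UNION_le) auto
  also have "\<dots> \<le> real (card G') * exp (m * sqrt \<gamma> - m * s\<^sup>2 / 2)"
    using E by (intro sum_bounded_above) auto
  also have "\<dots> \<le> real (card G) * exp (m * sqrt \<gamma> - m * s\<^sup>2 / 2)"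
    using \<open>card G' \<le> card G\<close> by (intro mult_right_mono) auto
  finally show ?thesis .
qed

section \<open>Document masses as functions of the parameter\<close>

text \<open>Independence of events includes their measurability; this is how the prior
  neighbourhoods of the truth are known to be measurable.\<close>

lemma (in prob_space) prob_Int_of_indep_event:
  assumes "indep_event A B"
  shows "A \<in> events" "B \<in> events" "prob (A \<inter> B) = prob A * prob B"
proof -
  have ind: "indep_events (case_bool A B) UNIV"
    using assms by (simp only: indep_event_def)
  then have ev: "case_bool A B b \<in> events" for b
    unfolding indep_events_def by (meson UNIV_I image_subset_iff)
  show "A \<in> events" "B \<in> events"
    using ev[of True] ev[of False] by simp_all
  have "prob (\<Inter>j\<in>UNIV. case_bool A B j) = (\<Prod>j\<in>UNIV. prob (case_bool A B j))"
    using ind unfolding indep_events_def by (meson finite UNIV_not_empty subset_UNIV)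
  then show "prob (A \<inter> B) = prob A * prob B"
    by (simp add: UNIV_bool Int_commute mult.commute)
qed

lemma maximal_pathsD:
  assumes "\<phi> \<in> maximal_paths T r"
  shows "0 < length \<phi>" "k < length \<phi> \<Longrightarrow> \<phi> ! k \<in> verts T"
proof -
  have "set \<phi> \<subseteq> verts T" "\<phi> \<noteq> []"
    using assms unfolding maximal_paths_def vwalk_def by blast+
  then show "0 < length \<phi>" "k < length \<phi> \<Longrightarrow> \<phi> ! k \<in> verts T"
    using nth_mem by (simp, blast)
qed

lemma topic_paramsD:
  assumes "(\<rho>, \<pi>) \<in> topic_params T r"
  shows "finite (maximal_paths T r)"
    and "u \<in> verts T \<Longrightarrow> 0 \<le> \<rho> u $ v" "u \<in> verts T \<Longrightarrow> \<rho> u $ v \<le> 1"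
    and "u \<in> verts T \<Longrightarrow> (\<Sum>v\<in>UNIV. \<rho> u $ v) = 1"
    and "\<phi> \<in> maximal_paths T r \<Longrightarrow> 0 \<le> \<pi> \<phi>" "\<phi> \<in> maximal_paths T r \<Longrightarrow> \<pi> \<phi> \<le> 1"
    and "(\<Sum>\<phi>\<in>maximal_paths T r. \<pi> \<phi>) = 1"
proof -
  have \<rho>: "\<rho> u \<in> prob_simplex" if "u \<in> verts T" for u
    using assms that unfolding topic_params_def PiE_iff by blast
  have \<pi>: "\<pi> \<phi> \<in> {0..1}" if "\<phi> \<in> maximal_paths T r" for \<phi>
    using assms that unfolding topic_params_def PiE_iff by blast
  show sum: "(\<Sum>\<phi>\<in>maximal_paths T r. \<pi> \<phi>) = 1"
    using assms unfolding topic_params_def by blast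
  \<comment> \<open>A sum over an infinite index set is 0 by convention, so weights of total 1 force
    finitely many paths.\<close>
  show "finite (maximal_paths T r)"
  proof (rule ccontr)
    assume "infinite (maximal_paths T r)"
    then show False using sum by simp
  qed
  show "\<phi> \<in> maximal_paths T r \<Longrightarrow> 0 \<le> \<pi> \<phi>" "\<phi> \<in> maximal_paths T r \<Longrightarrow> \<pi> \<phi> \<le> 1"
    using \<pi>[of \<phi>] by simp_all
  have *: "0 \<le> \<rho> u $ v" if "u \<in> verts T" for v u
    using \<rho>[OF that] unfolding prob_simplex_def by blast
  have **: "(\<Sum>v\<in>UNIV. \<rho> u $ v) = 1" if "u \<in> verts T" for u
    using \<rho>[OF that] unfolding prob_simplex_def by blast
  show "u \<in> verts T \<Longrightarrow> 0 \<le> \<rho> u $ v" "u \<in> verts T \<Longrightarrow> (\<Sum>v\<in>UNIV. \<rho> u $ v) = 1"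
    using * ** by blast+
  show "\<rho> u $ v \<le> 1" if "u \<in> verts T"
    using member_le_sum[of v UNIV "\<lambda>v. \<rho> u $ v"] *[OF that] **[OF that] by simp
qed

context
  fixes T :: "('a, 'b) pre_digraph" and r :: 'a and \<alpha> :: real
  assumes \<alpha>: "\<alpha> > 0"
begin

text \<open>Used on both sides: from below with a shrunken truth, from above with a rounded-up
  parameter. Neither need lie in the simplex.\<close>

lemma doc_mass_mono:
  fixes \<rho> \<rho>' :: "'a \<Rightarrow> real ^ 'v::finite"
  assumes "\<And>u v. u \<in> verts T \<Longrightarrow> 0 \<le> \<rho> u $ v" "\<And>u v. u \<in> verts T \<Longrightarrow> \<rho> u $ v \<le> \<rho>' u $ v"
    and "\<And>\<phi>. \<phi> \<in> maximal_paths T r \<Longrightarrow> 0 \<le> \<pi> \<phi>" "\<And>\<phi>. \<phi> \<in> maximal_paths T r \<Longrightarrow> \<pi> \<phi> \<le> \<pi>' \<phi>"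
  shows "doc_mass T r \<alpha> (\<rho>, \<pi>) xs \<le> doc_mass T r \<alpha> (\<rho>', \<pi>') xs"
  unfolding doc_mass_eq_path_mass fst_conv snd_conv
proof (rule sum_mono)
  fix \<phi> assume \<phi>: "\<phi> \<in> maximal_paths T r"
  note D = maximal_pathsD[OF \<phi>]
  have "path_mass \<alpha> (length \<phi>) (\<lambda>k. \<rho> (\<phi> ! k)) xs \<le> path_mass \<alpha> (length \<phi>) (\<lambda>k. \<rho>' (\<phi> ! k)) xs"
    using assms D by (intro path_mass_mono D \<alpha>) auto
  moreover have "0 \<le> path_mass \<alpha> (length \<phi>) (\<lambda>k. \<rho> (\<phi> ! k)) xs"
    using assms D by (intro path_mass_nonneg D \<alpha>) auto
  ultimately show "\<pi> \<phi> * path_mass \<alpha> (length \<phi>) (\<lambda>k. \<rho> (\<phi> ! k)) xs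
      \<le> \<pi>' \<phi> * path_mass \<alpha> (length \<phi>) (\<lambda>k. \<rho>' (\<phi> ! k)) xs"
    using assms(3,4)[OF \<phi>] by (intro mult_mono) auto
qed

lemma doc_mass_nonneg:
  fixes \<rho> :: "'a \<Rightarrow> real ^ 'v::finite"
  assumes "\<And>u v. u \<in> verts T \<Longrightarrow> 0 \<le> \<rho> u $ v" "\<And>\<phi>. \<phi> \<in> maximal_paths T r \<Longrightarrow> 0 \<le> \<pi> \<phi>"
  shows "0 \<le> doc_mass T r \<alpha> (\<rho>, \<pi>) xs"
  unfolding doc_mass_eq_path_mass fst_conv snd_conv
proof (intro sum_nonneg mult_nonneg_nonneg assms)
  fix \<phi> assume "\<phi> \<in> maximal_paths T r"
  note D = maximal_pathsD[OF this]
  show "0 \<le> path_mass \<alpha> (length \<phi>) (\<lambda>k. \<rho> (\<phi> ! k)) xs"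
    using assms D by (intro path_mass_nonneg D \<alpha>) auto
qed

text \<open>Degree \<open>length xs\<close> in the topics and 1 in the path weights: a common factor
  enters a document of length n with the power n + 1.\<close>

lemma doc_mass_scale:
  fixes \<rho> :: "'a \<Rightarrow> real ^ 'v::finite"
  shows "doc_mass T r \<alpha> (\<lambda>u. c *\<^sub>R \<rho> u, \<lambda>\<phi>. d * \<pi> \<phi>) xs = d * c ^ length xs * doc_mass T r \<alpha> (\<rho>, \<pi>) xs"
  unfolding doc_mass_eq_path_mass fst_conv snd_conv sum_distrib_left
proof (rule sum.cong)
  fix \<phi> assume \<phi>: "\<phi> \<in> maximal_paths T r"
  show "d * \<pi> \<phi> * path_mass \<alpha> (length \<phi>) (\<lambda>k. c *\<^sub>R \<rho> (\<phi> ! k)) xs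
      = d * c ^ length xs * (\<pi> \<phi> * path_mass \<alpha> (length \<phi>) (\<lambda>k. \<rho> (\<phi> ! k)) xs)"
    by (simp add: path_mass_scale[OF maximal_pathsD(1)[OF \<phi>] \<alpha>])
qed simp

text \<open>Lower every topic to the vector with all entries \<open>c\<close>; its mixtures have all
  entries \<open>c\<close> whatever \<beta> is. This yields the positivity of the true mass on which
  likelihood ratios rest.\<close>

lemma doc_mass_ge_power:
  fixes \<rho> :: "'a \<Rightarrow> real ^ 'v::finite"
  assumes "(\<rho>, \<pi>) \<in> topic_params T r" "0 \<le> c" "\<And>u v. u \<in> verts T \<Longrightarrow> c \<le> \<rho> u $ v"
  shows "c ^ length xs \<le> doc_mass T r \<alpha> (\<rho>, \<pi>) xs"
proof -
  note D = topic_paramsD[OF assms(1)]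
  have one: "path_mass \<alpha> (length \<phi>) (\<lambda>_. vec 1 :: real ^ 'v) xs = 1" if "\<phi> \<in> maximal_paths T r" for \<phi>
  proof -
    interpret dir: prob_space "dirichlet (length \<phi>) \<alpha>"
      using prob_space_dirichlet[OF maximal_pathsD(1)[OF that] \<alpha>] .
    note [measurable] = dirichlet_component_measurable[OF maximal_pathsD(1)[OF that] \<alpha>]
    have "AE \<beta> in dirichlet (length \<phi>) \<alpha>.
        (\<Prod>v\<in>UNIV. (\<Sum>k<length \<phi>. \<beta> k * (vec 1 :: real ^ 'v) $ v) ^ count_list xs v) = 1"
      using AE_dirichlet[OF maximal_pathsD(1)[OF that], of \<alpha>] by eventually_elim simp
    then have "path_mass \<alpha> (length \<phi>) (\<lambda>_. vec 1 :: real ^ 'v) xs = (LINT \<beta>|dirichlet (length \<phi>) \<alpha>. 1)"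
      unfolding path_mass_def by (intro integral_cong_AE) measurable
    then show ?thesis by (simp add: dir.prob_space)
  qed
  have "c ^ length xs = c ^ length xs * doc_mass T r \<alpha> (\<lambda>_. vec 1 :: real ^ 'v, \<pi>) xs"
    unfolding doc_mass_eq_path_mass fst_conv snd_conv
    using D(7) by (subst sum.cong[OF refl arg_cong2[where f = "(*)", OF refl one]]) simp_all
  also have "\<dots> = doc_mass T r \<alpha> (\<lambda>_. c *\<^sub>R vec 1 :: real ^ 'v, \<pi>) xs"
    using doc_mass_scale[of c "\<lambda>_. vec 1 :: real ^ 'v" 1 \<pi> xs] by simp
  also have "\<dots> \<le> doc_mass T r \<alpha> (\<rho>, \<pi>) xs"
    using assms D by (intro doc_mass_mono) auto
  finally show ?thesis .
qed

lemma sum_doc_mass: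
  fixes \<omega> :: "('a, 'v::finite) param"
  assumes "\<omega> \<in> topic_params T r"
  shows "(\<Sum>xs | length xs = n. doc_mass T r \<alpha> \<omega> xs) = 1"
proof -
  obtain \<rho> \<pi> where \<omega>: "\<omega> = (\<rho>, \<pi>)" by (cases \<omega>)
  note D = topic_paramsD[OF assms[unfolded \<omega>]]
  have "(\<Sum>xs | length xs = n. doc_mass T r \<alpha> \<omega> xs) = (\<Sum>\<phi>\<in>maximal_paths T r. \<pi> \<phi> *
      (\<Sum>xs | length xs = n. path_mass \<alpha> (length \<phi>) (\<lambda>k. \<rho> (\<phi> ! k)) xs))"
    unfolding doc_mass_eq_path_mass \<omega> by (subst sum.swap) (simp add: sum_distrib_left)
  also have "\<dots> = (\<Sum>\<phi>\<in>maximal_paths T r. \<pi> \<phi> * 1)"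
    by (intro sum.cong refl arg_cong2[where f = "(*)"] sum_path_mass_eq_1 D(2,4) \<alpha> maximal_pathsD)
  finally show ?thesis using D by simp
qed

lemma sum_doc_mass_le:
  fixes \<rho> :: "'a \<Rightarrow> real ^ 'v::finite"
  assumes "\<And>u v. u \<in> verts T \<Longrightarrow> 0 \<le> \<rho> u $ v" "\<And>u. u \<in> verts T \<Longrightarrow> (\<Sum>v\<in>UNIV. \<rho> u $ v) \<le> B"
    and "\<And>\<phi>. \<phi> \<in> maximal_paths T r \<Longrightarrow> 0 \<le> \<pi> \<phi>"
  shows "(\<Sum>xs | length xs = n. doc_mass T r \<alpha> (\<rho>, \<pi>) xs) \<le> (\<Sum>\<phi>\<in>maximal_paths T r. \<pi> \<phi>) * B ^ n"
proof -
  have "(\<Sum>xs | length xs = n. doc_mass T r \<alpha> (\<rho>, \<pi>) xs) = (\<Sum>\<phi>\<in>maximal_paths T r. \<pi> \<phi> *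
      (\<Sum>xs | length xs = n. path_mass \<alpha> (length \<phi>) (\<lambda>k. \<rho> (\<phi> ! k)) xs))"
    unfolding doc_mass_eq_path_mass by (subst sum.swap) (simp add: sum_distrib_left)
  also have "\<dots> \<le> (\<Sum>\<phi>\<in>maximal_paths T r. \<pi> \<phi> * B ^ n)"
    by (intro sum_mono mult_left_mono sum_path_mass_le assms \<alpha> maximal_pathsD)
  finally show ?thesis by (simp add: sum_distrib_right)
qed

text \<open>Evaluations at a node, a word or a path are continuous for the product topology, hence
  Borel, and the mass depends on the parameter only through them.\<close>

lemma doc_mass_measurable:
  fixes M :: "('a, 'v::finite) param measure"
  assumes "sets M = sets (param_space T r)"
  shows "(\<lambda>\<omega>. doc_mass T r \<alpha> \<omega> xs) \<in> borel_measurable M"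
proof -
  have cont: "f \<in> borel_measurable M" if "continuous_on UNIV f" for f :: "('a, 'v) param \<Rightarrow> real"
    unfolding measurable_cong_sets[OF assms refl] param_space_def
    by (intro measurable_restrict_space1 borel_measurable_continuous_onI that)
  have "(\<lambda>\<omega>. fst \<omega> u $ v) \<in> borel_measurable M" for u v
    by (rule cont[OF continuous_on_component[OF continuous_on_product_then_coordinatewise[
        OF continuous_on_fst[OF continuous_on_id]]]])
  moreover have "(\<lambda>\<omega>. snd \<omega> \<phi>) \<in> borel_measurable M" for \<phi>
    by (rule cont[OF continuous_on_product_then_coordinatewise[OF continuous_on_snd[OF continuous_on_id]]])
  ultimately show ?thesis unfolding doc_mass_eq_path_mass
    by (intro borel_measurable_sum borel_measurable_times path_mass_measurable maximal_pathsD(1) \<alpha>)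
qed

end

section \<open>Brackets by rounding up\<close>

text \<open>Rounding goes upward so that the grid parameter dominates the given one and its mass
  function is an upper bracket.\<close>

definition round_up :: "nat \<Rightarrow> real \<Rightarrow> real" where
  "round_up M x = of_int \<lceil>real M * x\<rceil> / real M"

definition unit_grid :: "nat \<Rightarrow> real set" where
  "unit_grid M = (\<lambda>j. real j / real M) ` {..M}"

lemma round_up_bounds:
  assumes "M > 0"
  shows "x \<le> round_up M x" "round_up M x \<le> x + 1 / M"
proof -
  have "real M * x \<le> of_int \<lceil>real M * x\<rceil>" "of_int \<lceil>real M * x\<rceil> \<le> real M * x + 1"
    by linarith+
  then show "x \<le> round_up M x" "round_up M x \<le> x + 1 / M"
    using assms by (simp_all add: round_up_def field_simps)
qed

lemma round_up_in_unit_grid: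
  assumes "M > 0" "0 \<le> x" "x \<le> 1"
  shows "round_up M x \<in> unit_grid M"
proof -
  have "0 \<le> real M * x" using assms by simp
  then have "0 \<le> \<lceil>real M * x\<rceil>" by linarith
  then obtain j where j: "\<lceil>real M * x\<rceil> = int j" by (rule zero_le_imp_eq_int[THEN exE])
  have "\<lceil>real M * x\<rceil> \<le> int M"
    using assms by (simp add: ceiling_le_iff mult_left_le)
  then show ?thesis using j by (auto simp: unit_grid_def round_up_def)
qed

lemma finite_unit_grid [simp]: "finite (unit_grid M)"
  and card_unit_grid_le: "card (unit_grid M) \<le> M + 1"
  unfolding unit_grid_def by (auto intro: card_image_le[THEN order_trans])

text \<open>Grid vectors need not sum to 1, since rounding up leaves the simplex. Extensionality
  keeps the set finite.\<close>

definition param_grid :: "('a, 'b) pre_digraph \<Rightarrow> 'a \<Rightarrow> nat \<Rightarrow> ('a, 'v::finite) param set" where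
  "param_grid T r M =
     (verts T \<rightarrow>\<^sub>E {x. \<forall>v. x $ v \<in> unit_grid M}) \<times> (maximal_paths T r \<rightarrow>\<^sub>E unit_grid M)"

lemma vec_grid:
  shows finite_vec_grid: "finite {x :: real ^ 'v::finite. \<forall>v. x $ v \<in> unit_grid M}"
    and card_vec_grid_le: "card {x :: real ^ 'v. \<forall>v. x $ v \<in> unit_grid M} \<le> (M + 1) ^ CARD('v)"
proof -
  have sub: "{x :: real ^ 'v. \<forall>v. x $ v \<in> unit_grid M} \<subseteq> vec_lambda ` (UNIV \<rightarrow>\<^sub>E unit_grid M)"
  proof
    fix x :: "real ^ 'v" assume "x \<in> {x. \<forall>v. x $ v \<in> unit_grid M}"
    then show "x \<in> vec_lambda ` (UNIV \<rightarrow>\<^sub>E unit_grid M)"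
      by (intro image_eqI[where x = "\<lambda>v. x $ v"]) auto
  qed
  have fin: "finite ((UNIV :: 'v set) \<rightarrow>\<^sub>E unit_grid M)"
    by (intro finite_PiE) auto
  show "finite {x :: real ^ 'v. \<forall>v. x $ v \<in> unit_grid M}"
    using finite_subset[OF sub] fin by simp
  have "card {x :: real ^ 'v. \<forall>v. x $ v \<in> unit_grid M} \<le> card ((UNIV :: 'v set) \<rightarrow>\<^sub>E unit_grid M)"
    using card_mono[OF finite_imageI[OF fin] sub] card_image_le[OF fin] by (rule order_trans)
  also have "\<dots> \<le> (M + 1) ^ CARD('v)"
    using card_unit_grid_le[of M] by (simp add: card_PiE power_mono)
  finally show "card {x :: real ^ 'v. \<forall>v. x $ v \<in> unit_grid M} \<le> (M + 1) ^ CARD('v)" .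
qed

lemma param_grid:
  fixes T :: "('a, 'b) pre_digraph"
  assumes "finite (verts T)" "finite (maximal_paths T r)"
  shows finite_param_grid: "finite (param_grid T r M :: ('a, 'v::finite) param set)"
    and card_param_grid_le: "card (param_grid T r M :: ('a, 'v) param set)
      \<le> (M + 1) ^ (CARD('v) * card (verts T) + card (maximal_paths T r))"
proof -
  show "finite (param_grid T r M :: ('a, 'v) param set)"
    unfolding param_grid_def using assms finite_vec_grid
    by (intro finite_cartesian_product finite_PiE) auto
  have "card {x :: real ^ 'v. \<forall>v. x $ v \<in> unit_grid M} ^ card (verts T) \<le> ((M + 1) ^ CARD('v)) ^ card (verts T)"
    by (intro power_mono card_vec_grid_le) simp
  moreover have "card (unit_grid M) ^ card (maximal_paths T r) \<le> (M + 1) ^ card (maximal_paths T r)"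
    by (intro power_mono card_unit_grid_le) simp
  ultimately show "card (param_grid T r M :: ('a, 'v) param set)
      \<le> (M + 1) ^ (CARD('v) * card (verts T) + card (maximal_paths T r))"
    using assms unfolding param_grid_def card_cartesian_product
    by (simp add: card_PiE power_add power_mult mult_mono)
qed

text \<open>With I paths and V words, rounding raises the total path weight to at most 1 + I / M and
  the total of each topic to at most 1 + V / M. The latter enters once per position, hence the power
  n; the 1 subtracted is the total mass of \<omega>.\<close>

lemma ex_upper_bracket:
  fixes \<omega> :: "('a, 'v::finite) param"
  assumes "\<alpha> > 0" "\<omega> \<in> topic_params T r" "M > 0"
  shows "\<exists>\<omega>'\<in>param_grid T r M. (\<forall>xs. doc_mass T r \<alpha> \<omega> xs \<le> doc_mass T r \<alpha> \<omega>' xs) \<and>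
    (\<Sum>xs | length xs = n. doc_mass T r \<alpha> \<omega>' xs - doc_mass T r \<alpha> \<omega> xs)
      \<le> (1 + card (maximal_paths T r) / M) * (1 + CARD('v) / M) ^ n - 1"
proof -
  obtain \<rho> \<pi> where \<omega>: "\<omega> = (\<rho>, \<pi>)" by (cases \<omega>)
  note D = topic_paramsD[OF assms(2)[unfolded \<omega>]]
  define \<rho>' where "\<rho>' = (\<lambda>u\<in>verts T. \<chi> v. round_up M (\<rho> u $ v))"
  define \<pi>' where "\<pi>' = (\<lambda>\<phi>\<in>maximal_paths T r. round_up M (\<pi> \<phi>))"
  have "(\<rho>', \<pi>') \<in> param_grid T r M"
    unfolding param_grid_def \<rho>'_def \<pi>'_def
    using D assms(3) by (auto intro!: round_up_in_unit_grid)
  moreover have le: "doc_mass T r \<alpha> \<omega> xs \<le> doc_mass T r \<alpha> (\<rho>', \<pi>') xs" for xs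
    unfolding \<omega> using D round_up_bounds(1)[OF assms(3)]
    by (intro doc_mass_mono assms(1)) (auto simp: \<rho>'_def \<pi>'_def)
  moreover have "(\<Sum>xs | length xs = n. doc_mass T r \<alpha> (\<rho>', \<pi>') xs - doc_mass T r \<alpha> \<omega> xs)
      \<le> (1 + card (maximal_paths T r) / M) * (1 + CARD('v) / M) ^ n - 1"
  proof -
    have "(\<Sum>xs | length xs = n. doc_mass T r \<alpha> (\<rho>', \<pi>') xs)
        \<le> (\<Sum>\<phi>\<in>maximal_paths T r. \<pi>' \<phi>) * (1 + CARD('v) / M) ^ n"
    proof (rule sum_doc_mass_le[OF assms(1)])
      fix u assume u: "u \<in> verts T"
      have "(\<Sum>v\<in>UNIV. \<rho>' u $ v) \<le> (\<Sum>v\<in>UNIV. \<rho> u $ v + 1 / M)"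
        using u round_up_bounds(2)[OF assms(3)] by (intro sum_mono) (simp add: \<rho>'_def)
      then show "(\<Sum>v\<in>UNIV. \<rho>' u $ v) \<le> 1 + CARD('v) / M"
        using D(4)[OF u] by (simp add: sum.distrib)
      show "0 \<le> \<rho>' u $ v" for v
        using order_trans[OF D(2)[OF u] round_up_bounds(1)[OF assms(3)]] u by (simp add: \<rho>'_def)
    next
      fix \<phi> assume \<phi>: "\<phi> \<in> maximal_paths T r"
      show "0 \<le> \<pi>' \<phi>"
        using order_trans[OF D(5)[OF \<phi>] round_up_bounds(1)[OF assms(3)]] \<phi> by (simp add: \<pi>'_def)
    qed
    also have "\<dots> \<le> (1 + card (maximal_paths T r) / M) * (1 + CARD('v) / M) ^ n"
    proof (rule mult_right_mono)
      have "(\<Sum>\<phi>\<in>maximal_paths T r. \<pi>' \<phi>) \<le> (\<Sum>\<phi>\<in>maximal_paths T r. \<pi> \<phi> + 1 / M)"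
        using round_up_bounds(2)[OF assms(3)] by (intro sum_mono) (simp add: \<pi>'_def)
      then show "(\<Sum>\<phi>\<in>maximal_paths T r. \<pi>' \<phi>) \<le> 1 + card (maximal_paths T r) / M"
        using D(7) by (simp add: sum.distrib)
    qed simp
    finally show ?thesis
      by (simp add: sum_subtractf sum_doc_mass[OF assms(1,2)])
  qed
  ultimately show ?thesis by blast
qed

text \<open>The choice of \<open>M\<close> bounds the product by exp x with x = (I + V) / m^2. The
  bound is written as a square because affinities pay its square root, and m times that root is a
  constant.\<close>

lemma bracket_size_bound:
  fixes I V n m :: nat
  assumes "n > 0" "m > 0"
  defines "M \<equiv> n * m\<^sup>2"
  shows "(1 + I / M) * (1 + V / M) ^ n - 1 \<le> (sqrt ((I + V) * exp (I + V)) / m)\<^sup>2"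
proof -
  define x :: real where "x = (I + V) / m\<^sup>2"
  have "(1 + V / M) ^ n \<le> exp (V / M) ^ n"
    by (intro power_mono exp_ge_add_one_self) simp
  also have "\<dots> = exp (V / m\<^sup>2)"
    using assms by (simp add: M_def flip: exp_of_nat_mult)
  finally have 1: "(1 + V / M) ^ n \<le> exp (V / m\<^sup>2)" .
  have "1 + I / M \<le> exp (I / M)" by (rule exp_ge_add_one_self)
  also have "\<dots> \<le> exp (I / m\<^sup>2)"
    using assms by (simp add: M_def frac_le)
  finally have "(1 + I / M) * (1 + V / M) ^ n \<le> exp (I / m\<^sup>2) * exp (V / m\<^sup>2)"
    using 1 by (intro mult_mono) auto
  also have "\<dots> = exp x"
    by (simp add: x_def add_divide_distrib flip: exp_add)
  \<comment> \<open>This is 1 - x \<le> exp (- x) multiplied by exp x; it keeps in front the factor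
    x of order 1 / m^2.\<close>
  also have "exp x \<le> 1 + x * exp x"
  proof -
    have "(1 - x) * exp x \<le> exp (- x) * exp x"
      using exp_ge_add_one_self[of "- x"] by (intro mult_right_mono) auto
    then show ?thesis by (simp add: algebra_simps flip: exp_add)
  qed
  also have "x \<le> I + V"
  proof -
    have "1 \<le> (real m)\<^sup>2" using assms by simp
    then show ?thesis
      using mult_left_mono[of 1 "(real m)\<^sup>2" "real (I + V)"] by (simp add: x_def divide_le_eq)
  qed
  then have "1 + x * exp x \<le> 1 + x * exp (I + V)"
    by (intro add_left_mono mult_left_mono) (auto simp: x_def)
  finally show ?thesis
    by (simp add: x_def power_divide)
qed

text \<open>The bound ln (1 - x) \<ge> - x - 2 x^2 is valid up to x = 1/2, hence N \<ge> 2; at x = 1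
  / N it gives - 1 - 2 / N \<ge> - 2 for the logarithm of the power.\<close>

lemma exp_minus_two_le_power:
  assumes "N \<ge> 2"
  shows "exp (- 2) \<le> (1 - 1 / real N) ^ N"
proof -
  have N: "real N \<ge> 2" using assms by simp
  have "- 2 \<le> real N * (- (1 / N) - 2 * (1 / N)\<^sup>2)"
    using N by (simp add: field_simps power2_eq_square)
  also have "\<dots> \<le> real N * ln (1 - 1 / N)"
    using N by (intro mult_left_mono ln_one_minus_pos_lower_bound) (auto simp: field_simps)
  finally have "exp (- 2) \<le> exp (real N * ln (1 - 1 / N))" by simp
  also have "\<dots> = (1 - 1 / real N) ^ N"
    using N by (simp add: exp_of_nat_mult)
  finally show ?thesis .
qed

text \<open>The radius has denominator N = m (n + 1) because m documents, each with n words and one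
  path weight, produce the exponent N in (1 - 1 / N)^N \<ge> exp (- 2). The dimension
  \<open>d\<close> counts all V entries of a topic, not V - 1, since each entry is rounded
  separately.\<close>

lemma posterior_finite_sample:
  fixes T :: "('a, 'b) pre_digraph" and prior :: "('a, 'v::finite) param measure" and m n :: nat
    and b s \<eta> :: real
  assumes \<alpha>: "\<alpha> > 0" and fin: "finite (verts T)"
    and prior: "prob_space prior" "sets prior = sets (param_space T r)"
    and \<omega>0: "(\<rho>0, \<pi>0) \<in> topic_params T r"
    and c: "c > 0" "\<And>u v. u \<in> verts T \<Longrightarrow> c \<le> \<rho>0 u $ v" "\<And>\<phi>. \<phi> \<in> maximal_paths T r \<Longrightarrow> c \<le> \<pi>0 \<phi>"
    and nm: "n > 0" "m > 0"
    and B: "B \<in> sets prior" "b > 0" "b \<le> measure prior B"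
      "\<And>\<rho> \<pi> u. (\<rho>, \<pi>) \<in> B \<Longrightarrow> u \<in> verts T \<Longrightarrow> norm (\<rho> u - \<rho>0 u) \<le> c / real (m * (n + 1))"
      "\<And>\<rho> \<pi> \<phi>. (\<rho>, \<pi>) \<in> B \<Longrightarrow> \<phi> \<in> maximal_paths T r \<Longrightarrow> \<bar>\<pi> \<phi> - \<pi>0 \<phi>\<bar> \<le> c / real (m * (n + 1))"
    and s: "s \<ge> 0" "exp (- real m * s\<^sup>2) \<le> \<eta> * (exp (- 2) * b)"
  defines "P \<equiv> Pi\<^sub>M (UNIV :: nat set) (\<lambda>_. doc_dist T r \<alpha> n (\<rho>0, \<pi>0))"
    and "d \<equiv> CARD('v) * card (verts T) + card (maximal_paths T r)"
    and "q \<equiv> card (maximal_paths T r) + CARD('v)"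
  shows "measure P {X \<in> space P. \<eta> < \<bar>posterior prior (doc_mass T r \<alpha>) m X
      (hellinger_far T r \<alpha> n (\<rho>0, \<pi>0) s)\<bar>}
    \<le> (real (n * m\<^sup>2 + 1)) ^ d * exp (sqrt (q * exp q) - m * s\<^sup>2 / 2)"
proof -
  let ?A = "{xs :: 'v list. length xs = n}"
  let ?F = "hellinger_far T r \<alpha> n (\<rho>0, \<pi>0) s"
  define N where "N = m * (n + 1)"
  define M where "M = n * m\<^sup>2"
  define Q where "Q = sqrt (q * exp q)"
  define G where "G = doc_mass T r \<alpha> ` (param_grid T r M :: ('a, 'v) param set)"
  have "N \<ge> 2" using nm mult_le_mono[of 1 m 2 "n + 1"] by (simp add: N_def)
  then have N: "0 < 1 - 1 / real N" by simp
  have "M > 0" using nm by (simp add: M_def)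
  note D0 = topic_paramsD[OF \<omega>0]
  have space: "space prior = topic_params T r"
    using sets_eq_imp_space_eq[OF prior(2)] by (simp add: param_space_def space_restrict_space)
  have finG: "finite G"
    unfolding G_def using fin D0 by (intro finite_imageI finite_param_grid)
  have "card G \<le> (M + 1) ^ d"
    unfolding G_def d_def
    using card_image_le[OF finite_param_grid[OF fin D0(1)]] card_param_grid_le[OF fin D0(1)]
    by (rule order_trans)
  then have cardG: "real (card G) \<le> real (n * m\<^sup>2 + 1) ^ d"
    unfolding M_def of_nat_power[symmetric] of_nat_le_iff .
  have lik: "(1 - 1 / real N) ^ (n + 1) * doc_mass T r \<alpha> (\<rho>0, \<pi>0) xs \<le> doc_mass T r \<alpha> \<omega> xs"
    if "\<omega> \<in> B" "xs \<in> ?A" for \<omega> xs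
  proof -
    obtain \<rho> \<pi> where \<omega>: "\<omega> = (\<rho>, \<pi>)" by (cases \<omega>)
    have \<rho>: "(1 - 1 / real N) * \<rho>0 u $ v \<le> \<rho> u $ v" if "u \<in> verts T" for u v
    proof -
      have "\<bar>(\<rho> u - \<rho>0 u) $ v\<bar> \<le> c / N"
        using component_le_norm_cart B(4)[OF \<open>\<omega> \<in> B\<close>[unfolded \<omega>] that] unfolding N_def
        by (rule order_trans)
      \<comment> \<open>The lower bound \<open>c\<close> on the truth converts the absolute error
        into a relative one.\<close>
      moreover have "c / N \<le> \<rho>0 u $ v / N"
        using c(2)[OF that] by (intro divide_right_mono) auto
      ultimately show ?thesis by (simp add: algebra_simps abs_le_iff)
    qed
    have \<pi>: "(1 - 1 / real N) * \<pi>0 \<phi> \<le> \<pi> \<phi>" if "\<phi> \<in> maximal_paths T r" for \<phi>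
    proof -
      have "\<bar>\<pi> \<phi> - \<pi>0 \<phi>\<bar> \<le> c / N"
        using B(5) \<open>\<omega> \<in> B\<close> that unfolding \<omega> N_def by blast
      moreover have "c / N \<le> \<pi>0 \<phi> / N"
        using c(3)[OF that] by (intro divide_right_mono) auto
      ultimately show ?thesis by (simp add: algebra_simps abs_le_iff)
    qed
    have "(1 - 1 / real N) ^ (n + 1) * doc_mass T r \<alpha> (\<rho>0, \<pi>0) xs
        = doc_mass T r \<alpha> (\<lambda>u. (1 - 1 / real N) *\<^sub>R \<rho>0 u, \<lambda>\<phi>. (1 - 1 / real N) * \<pi>0 \<phi>) xs"
      using \<open>xs \<in> ?A\<close> by (simp add: doc_mass_scale[OF \<alpha>])
    also have "\<dots> \<le> doc_mass T r \<alpha> (\<rho>, \<pi>) xs"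
      using N \<rho> \<pi> D0 by (intro doc_mass_mono \<alpha>) (auto intro!: mult_nonneg_nonneg intro: less_imp_le)
    finally show ?thesis by (simp add: \<omega>)
  qed
  have "measure P {X \<in> space P. \<eta> < \<bar>posterior prior (doc_mass T r \<alpha>) m X ?F\<bar>}
      \<le> real (card G) * exp (m * sqrt ((Q / m)\<^sup>2) - m * s\<^sup>2 / 2)"
    unfolding P_def doc_dist_def
  proof (rule posterior_tail_bound[where B = B and d = "(1 - 1 / real N) ^ (n + 1)"])
    show "0 < doc_mass T r \<alpha> (\<rho>0, \<pi>0) xs" for xs
      using doc_mass_ge_power[OF \<alpha> \<omega>0 less_imp_le[OF c(1)] c(2), of xs] zero_less_power[OF c(1), of "length xs"]
      by simp
    show "0 \<le> doc_mass T r \<alpha> \<omega> xs" if "\<omega> \<in> space prior" for \<omega> xs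
    proof -
      obtain \<rho> \<pi> where \<omega>: "\<omega> = (\<rho>, \<pi>)" by (cases \<omega>)
      note D = topic_paramsD[OF that[unfolded space \<omega>]]
      show ?thesis
        unfolding \<omega> by (intro doc_mass_nonneg[OF \<alpha>] D)
    qed
    show "0 < measure prior B" using B by simp
    show "?F \<subseteq> space prior" by (auto simp: space hellinger_far_def)
    show "s \<le> hellinger_dist ?A (doc_mass T r \<alpha> (\<rho>0, \<pi>0)) (doc_mass T r \<alpha> \<omega>)" if "\<omega> \<in> ?F" for \<omega>
      using that by (simp add: hellinger_far_def)
    show "\<exists>g\<in>G. (\<forall>xs\<in>?A. doc_mass T r \<alpha> \<omega> xs \<le> g xs) \<and> (\<Sum>xs\<in>?A. g xs - doc_mass T r \<alpha> \<omega> xs) \<le> (Q / m)\<^sup>2"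
      if "\<omega> \<in> ?F" for \<omega>
    proof -
      have "\<omega> \<in> topic_params T r" using that by (simp add: hellinger_far_def)
      from ex_upper_bracket[OF \<alpha> this \<open>M > 0\<close>, of n]
      obtain \<omega>' where \<omega>': "\<omega>' \<in> param_grid T r M" "\<And>xs. doc_mass T r \<alpha> \<omega> xs \<le> doc_mass T r \<alpha> \<omega>' xs"
        "(\<Sum>xs\<in>?A. doc_mass T r \<alpha> \<omega>' xs - doc_mass T r \<alpha> \<omega> xs)
          \<le> (1 + card (maximal_paths T r) / M) * (1 + CARD('v) / M) ^ n - 1"
        by blast
      moreover have "(1 + card (maximal_paths T r) / M) * (1 + CARD('v) / M) ^ n - 1 \<le> (Q / m)\<^sup>2"
        using bracket_size_bound[OF nm] unfolding M_def Q_def q_def by simp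
      ultimately show ?thesis unfolding G_def by (meson imageI order_trans)
    qed
    show "exp (- real m * s\<^sup>2) \<le> \<eta> * (((1 - 1 / real N) ^ (n + 1)) ^ m * measure prior B)"
    proof -
      have "exp (- 2) \<le> ((1 - 1 / real N) ^ (n + 1)) ^ m"
        using exp_minus_two_le_power[OF \<open>N \<ge> 2\<close>]
        by (simp add: N_def mult.commute flip: power_mult del: power_Suc)
      then have "exp (- 2) * b \<le> ((1 - 1 / real N) ^ (n + 1)) ^ m * measure prior B"
        using B(2,3) N by (intro mult_mono zero_le_power) auto
      \<comment> \<open>Forced by the assumption on \<open>s\<close>: an exponential is at most
        \<eta> times a positive number.\<close>
      moreover have "\<eta> > 0"
        using less_le_trans[OF exp_gt_zero s(2)] mult_pos_pos[OF exp_gt_zero B(2)]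
        by (rule zero_less_mult_pos2)
      ultimately show ?thesis
        using s(2) by (meson mult_left_mono less_imp_le order_trans)
    qed
    show "(\<Sum>xs\<in>?A. doc_mass T r \<alpha> \<omega> xs) = 1" if "\<omega> \<in> space prior" for \<omega>
      using that unfolding space by (rule sum_doc_mass[OF \<alpha>])
    show "(\<Sum>xs\<in>?A. doc_mass T r \<alpha> (\<rho>0, \<pi>0) xs) = 1"
      using \<omega>0 by (rule sum_doc_mass[OF \<alpha>])
    show "(\<lambda>\<omega>. doc_mass T r \<alpha> \<omega> xs) \<in> borel_measurable prior" for xs
      using prior(2) by (rule doc_mass_measurable[OF \<alpha>])
    show "0 < (1 - 1 / real N) ^ (n + 1)"
      using N by (rule zero_less_power)
  qed (fact | rule finite_lists_length lik)+
  also have "m * sqrt ((Q / m)\<^sup>2) = Q"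
    using nm by (simp add: Q_def)
  also have "real (card G) * exp (Q - m * s\<^sup>2 / 2) \<le> real (n * m\<^sup>2 + 1) ^ d * exp (Q - m * s\<^sup>2 / 2)"
    using cardG by (rule mult_right_mono) simp
  finally show ?thesis unfolding Q_def .
qed

section \<open>Contraction\<close>

text \<open>\<open>Ns\<close> is the sequence inside the logarithm, so that both regimes are
  instances: m itself for fixed n, the maximum for growing n. Measured in powers of
  \<open>Ns\<close>, the radius costs degree 2 per prior dimension and the grid degree 3 per rounded
  coordinate; \<open>a\<close> absorbs constants that may depend on a fixed n.\<close>

lemma posterior_vanishes:
  fixes T :: "('a, 'b) pre_digraph" and prior :: "('a, 'v::finite) param measure"
    and ms ns Ns :: "nat \<Rightarrow> nat" and C a b :: real and D :: nat
  assumes \<alpha>: "\<alpha> > 0" and fin: "finite (verts T)"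
    and prior: "prob_space prior" "sets prior = sets (param_space T r)"
    and \<omega>0: "(\<rho>0, \<pi>0) \<in> topic_params T r"
    and c: "c > 0" "\<And>u v. u \<in> verts T \<Longrightarrow> c \<le> \<rho>0 u $ v" "\<And>\<phi>. \<phi> \<in> maximal_paths T r \<Longrightarrow> c \<le> \<pi>0 \<phi>"
    and b: "b > 0" "\<forall>\<^sub>F \<epsilon> in at_right 0. \<exists>B\<in>sets prior. b * \<epsilon> ^ D \<le> measure prior B \<and>
      (\<forall>(\<rho>, \<pi>)\<in>B. (\<forall>u\<in>verts T. norm (\<rho> u - \<rho>0 u) \<le> \<epsilon>) \<and>
        (\<forall>\<phi>\<in>maximal_paths T r. \<bar>\<pi> \<phi> - \<pi>0 \<phi>\<bar> \<le> \<epsilon>))"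
    and ms: "filterlim ms at_top sequentially" and ns: "\<forall>\<^sub>F k in sequentially. 0 < ns k"
    and Ns: "filterlim Ns at_top sequentially" "a > 0"
      "\<forall>\<^sub>F k in sequentially. real (ms k * (ns k + 1)) \<le> a * real (Ns k) ^ 2"
      "\<forall>\<^sub>F k in sequentially. real (ns k * (ms k)\<^sup>2 + 1) \<le> a * real (Ns k) ^ 3"
  defines "d \<equiv> CARD('v) * card (verts T) + card (maximal_paths T r)"
  assumes C: "C \<ge> 1 + 2 * real D + 6 * real d"
  shows "vanishes_in_prob (\<lambda>k. Pi\<^sub>M (UNIV :: nat set) (\<lambda>_. doc_dist T r \<alpha> (ns k) (\<rho>0, \<pi>0)))
    (\<lambda>k X. posterior prior (doc_mass T r \<alpha>) (ms k) X
      (hellinger_far T r \<alpha> (ns k) (\<rho>0, \<pi>0) (C * sqrt (ln (real (Ns k)) / real (ms k)))))"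
  unfolding vanishes_in_prob_def
proof (intro allI impI)
  fix \<eta> :: real assume "\<eta> > 0"
  define s where "s k = C * sqrt (ln (real (Ns k)) / real (ms k))" for k
  define Q where "Q = sqrt (real (card (maximal_paths T r) + CARD('v)) * exp (real (card (maximal_paths T r) + CARD('v))))"
  \<comment> \<open>The factor of N^(- 2 D) in the allowance for the numerator, once the radius is
    lowered to c / (a N^2), where N stands for \<open>Ns k\<close>.\<close>
  define \<kappa> where "\<kappa> = \<eta> * (exp (- 2) * (b * (c / a) ^ D))"
  have "C \<ge> 1" using C by simp
  \<comment> \<open>Hence C^2 exceeds 2 D, for the prior mass, and 6 d, for the number of brackets;
    the latter is doubled because half of m s^2 is spent on the likelihood threshold.\<close>
  then have "C\<^sup>2 \<ge> C" by (simp add: power2_eq_square)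
  then have C2: "2 * real D - C\<^sup>2 < 0" "3 * real d - C\<^sup>2 / 2 < 0" using C by auto
  have NsR: "filterlim (\<lambda>k. real (Ns k)) at_top sequentially"
    using Ns(1) by (rule filterlim_compose[OF filterlim_real_sequentially])
  have msR: "filterlim (\<lambda>k. real (ms k)) at_top sequentially"
    using ms by (rule filterlim_compose[OF filterlim_real_sequentially])
  have ms1: "\<forall>\<^sub>F k in sequentially. 1 \<le> ms k" and Ns1: "\<forall>\<^sub>F k in sequentially. 1 \<le> Ns k"
    using ms Ns(1) unfolding filterlim_at_top by blast+
  have "\<kappa> > 0" using \<open>\<eta> > 0\<close> b c(1) Ns(2) by (simp add: \<kappa>_def)
  then have kap: "\<forall>\<^sub>F k in sequentially. real (Ns k) powr (2 * D - C\<^sup>2) < \<kappa>"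
    using tendsto_neg_powr[OF C2(1) NsR] by (simp add: order_tendsto_iff)
  \<comment> \<open>The prior mass is controlled for small positive radii; convergence to 0 from the
    right transfers this to the radii of the sequence.\<close>
  have "filterlim (\<lambda>k. c / real (ms k * (ns k + 1))) (at_right 0) sequentially"
  proof (rule tendsto_imp_filterlim_at_right)
    have "(\<lambda>k. c / real (ms k)) \<longlonglongrightarrow> 0"
      by (intro tendsto_divide_0[OF tendsto_const] filterlim_at_top_imp_at_infinity msR)
    then show "(\<lambda>k. c / real (ms k * (ns k + 1))) \<longlonglongrightarrow> 0"
    proof (rule tendsto_sandwich[OF _ _ tendsto_const, rotated 2])
      show "\<forall>\<^sub>F k in sequentially. 0 \<le> c / real (ms k * (ns k + 1))"
        using c(1) by (intro always_eventually allI) simp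
      show "\<forall>\<^sub>F k in sequentially. c / real (ms k * (ns k + 1)) \<le> c / real (ms k)"
        using ms1
      proof eventually_elim
        case (elim k)
        have "real (ms k) \<le> real (ms k * (ns k + 1))" unfolding of_nat_le_iff by simp
        then show ?case using elim c(1)
            by (intro divide_left_mono mult_pos_pos) (auto intro: add_pos_nonneg)
      qed
    qed
    show "\<forall>\<^sub>F k in sequentially. 0 < c / real (ms k * (ns k + 1))"
      using ms1 by eventually_elim (use c(1) in \<open>auto intro!: divide_pos_pos add_pos_nonneg\<close>)
  qed
  from filterlim_iff[THEN iffD1, OF this, rule_format, OF b(2)]
  have mass: "\<forall>\<^sub>F k in sequentially. \<exists>B\<in>sets prior.
      b * (c / real (ms k * (ns k + 1))) ^ D \<le> measure prior B \<and>
      (\<forall>(\<rho>, \<pi>)\<in>B. (\<forall>u\<in>verts T. norm (\<rho> u - \<rho>0 u) \<le> c / real (ms k * (ns k + 1))) \<and>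
        (\<forall>\<phi>\<in>maximal_paths T r. \<bar>\<pi> \<phi> - \<pi>0 \<phi>\<bar> \<le> c / real (ms k * (ns k + 1))))" .
  define P where "P k = Pi\<^sub>M (UNIV :: nat set) (\<lambda>_. doc_dist T r \<alpha> (ns k) (\<rho>0, \<pi>0))" for k
  define Y where "Y k X = posterior prior (doc_mass T r \<alpha>) (ms k) X
      (hellinger_far T r \<alpha> (ns k) (\<rho>0, \<pi>0) (s k))" for k X
  have bound: "\<forall>\<^sub>F k in sequentially. measure (P k) {X \<in> space (P k). \<eta> < \<bar>Y k X\<bar>}
      \<le> a ^ d * exp Q * real (Ns k) powr (3 * d - C\<^sup>2 / 2)"
    using ms1 Ns1 ns kap mass Ns(3,4)
  proof eventually_elim
    case (elim k)
    define m n N where "m = ms k" and "n = ns k" and "N = real (Ns k)"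
    note elim = elim[folded m_def n_def N_def]
    have N: "N \<ge> 1" using elim(2) by (simp add: N_def)
    have m: "m > 0" "n > 0" using elim by simp_all
    \<comment> \<open>The rate is made for this identity: exp (- m s^2) becomes the power N^(-
      C^2).\<close>
    have ms2: "real m * (s k)\<^sup>2 = C\<^sup>2 * ln N"
      using m N by (simp add: s_def m_def[symmetric] N_def[symmetric] power_mult_distrib)
    from elim(5) obtain B where B: "B \<in> sets prior" "b * (c / real (m * (n + 1))) ^ D \<le> measure prior B"
      "\<And>\<rho> \<pi> u. (\<rho>, \<pi>) \<in> B \<Longrightarrow> u \<in> verts T \<Longrightarrow> norm (\<rho> u - \<rho>0 u) \<le> c / real (m * (n + 1))"
      "\<And>\<rho> \<pi> \<phi>. (\<rho>, \<pi>) \<in> B \<Longrightarrow> \<phi> \<in> maximal_paths T r \<Longrightarrow> \<bar>\<pi> \<phi> - \<pi>0 \<phi>\<bar> \<le> c / real (m * (n + 1))"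
      by blast
    have b0: "b * (c / real (m * (n + 1))) ^ D > 0"
      using b(1) c(1) m
      by (intro mult_pos_pos zero_less_power divide_pos_pos) (auto intro: add_pos_nonneg)
    have "0 \<le> s k" using N \<open>C \<ge> 1\<close> by (simp add: s_def N_def[symmetric])
    moreover have "exp (- real m * (s k)\<^sup>2) \<le> \<eta> * (exp (- 2) * (b * (c / real (m * (n + 1))) ^ D))"
    proof -
      have "exp (- real m * (s k)\<^sup>2) = N powr (- (C\<^sup>2))"
        using N ms2 by (simp add: powr_def)
      \<comment> \<open>The power N^(- 2 D) is set aside for the prior mass of the neighbourhood;
        the other factor, still a negative power, falls below \<kappa>.\<close>
      also have "\<dots> = N powr (2 * D - C\<^sup>2) / N ^ (2 * D)"
        using N powr_diff[of N "2 * D - C\<^sup>2" "2 * D"] by (simp add: powr_realpow flip: of_nat_mult)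
      also have "\<dots> \<le> \<kappa> / N ^ (2 * D)"
        using elim(4) N by (intro divide_right_mono) auto
      also have "\<dots> = \<eta> * (exp (- 2) * (b * (c / (a * N\<^sup>2)) ^ D))"
        by (simp add: \<kappa>_def power_divide power_mult_distrib power_mult)
      also have "\<dots> \<le> \<eta> * (exp (- 2) * (b * (c / real (m * (n + 1))) ^ D))"
      proof -
        have "c / (a * N\<^sup>2) \<le> c / real (m * (n + 1))"
          using elim(6) c(1) m N Ns(2)
          by (intro divide_left_mono mult_pos_pos) (auto intro: add_pos_nonneg)
        then show ?thesis
          using \<open>\<eta> > 0\<close> b(1) c(1) Ns(2) by (intro mult_left_mono power_mono) auto
      qed
      finally show ?thesis .
    qed
    ultimately have "measure (P k) {X \<in> space (P k). \<eta> < \<bar>Y k X\<bar>}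
        \<le> (real (n * m\<^sup>2 + 1)) ^ d * exp (Q - m * (s k)\<^sup>2 / 2)"
      unfolding P_def Y_def Q_def d_def m_def n_def
      by (intro posterior_finite_sample[OF \<alpha> fin prior \<omega>0 c, where B = B
            and b = "b * (c / real (m * (n + 1))) ^ D"])
        (use B m b0 in \<open>simp_all add: m_def n_def\<close>)
    also have "\<dots> \<le> (a * N ^ 3) ^ d * exp (Q - m * (s k)\<^sup>2 / 2)"
      using elim(7) by (intro mult_right_mono power_mono) auto
    also have "\<dots> = a ^ d * exp Q * N powr (3 * d - C\<^sup>2 / 2)"
    proof -
      have "exp (Q - m * (s k)\<^sup>2 / 2) = exp Q * N powr (- (C\<^sup>2 / 2))"
        using N ms2 by (simp add: powr_def flip: exp_add)
      moreover have "N powr (3 * d - C\<^sup>2 / 2) = N ^ (3 * d) * N powr (- (C\<^sup>2 / 2))"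
        using N powr_add[of N "3 * d" "- (C\<^sup>2 / 2)"] powr_realpow[of N "3 * d"] by simp
      ultimately show ?thesis by (simp add: power_mult_distrib power_mult)
    qed
    finally show ?case unfolding N_def .
  qed
  have "(\<lambda>k. a ^ d * exp Q * real (Ns k) powr (3 * d - C\<^sup>2 / 2)) \<longlonglongrightarrow> 0"
    using tendsto_mult_right_zero[OF tendsto_neg_powr[OF C2(2) NsR]] by simp
  then have "(\<lambda>k. measure (P k) {X \<in> space (P k). \<eta> < \<bar>Y k X\<bar>}) \<longlonglongrightarrow> 0"
    by (rule tendsto_sandwich[OF _ bound tendsto_const, rotated]) simp
  then show "(\<lambda>k. measure (Pi\<^sub>M UNIV (\<lambda>_. doc_dist T r \<alpha> (ns k) (\<rho>0, \<pi>0)))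
      {X \<in> space (Pi\<^sub>M UNIV (\<lambda>_. doc_dist T r \<alpha> (ns k) (\<rho>0, \<pi>0))). \<eta> < \<bar>posterior prior (doc_mass T r \<alpha>) (ms k) X
        (hellinger_far T r \<alpha> (ns k) (\<rho>0, \<pi>0) (C * sqrt (ln (real (Ns k)) / real (ms k))))\<bar>}) \<longlonglongrightarrow> 0"
    unfolding P_def Y_def s_def .
qed

text \<open>The threshold found for \<open>C\<close> depends only on the numbers of nodes, words and
  paths, so it can be fixed before the sequences of the second claim.\<close>

theorem theorem3:
  fixes T :: "('a, 'b) pre_digraph" and r :: 'a and J :: nat
    and \<alpha> c0 c1 c2 c3 \<delta> :: real
    and prior :: "('a, 'v::finite) param measure"
    and \<rho>0 :: "'a \<Rightarrow> real ^ 'v" and \<pi>0 :: "'a list \<Rightarrow> real"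
  assumes tree: "directed_rooted_tree T r"
    and same_length: "\<forall>\<phi>\<in>maximal_paths T r. length \<phi> = J"
    and pos: "\<alpha> > 0" "c0 > 0" "c1 > 0" "c2 > 0" "c3 > 0" "\<delta> > 0"
    and prior: "prob_space prior" "sets prior = sets (param_space T r)"
    and bounded_below: "\<forall>(\<rho>, \<pi>)\<in>measure_support prior.
      (\<forall>u\<in>verts T. \<forall>v. c0 \<le> \<rho> u $ v) \<and> (\<forall>\<phi>\<in>maximal_paths T r. c1 \<le> \<pi> \<phi>)"
    and corners: "\<forall>(\<rho>, \<pi>)\<in>measure_support prior.
      \<forall>\<phi>\<in>maximal_paths T r. non_obtuse_corners \<delta> (component_polytope \<rho> \<phi>)"
    and true_param: "(\<rho>0, \<pi>0) \<in> measure_support prior"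
    and prior_mass: "\<forall>\<^sub>F \<epsilon> in at_right 0.
      measure prior {(\<rho>, \<pi>) \<in> space prior. \<forall>u\<in>verts T. norm (\<rho> u - \<rho>0 u) \<le> \<epsilon>}
        \<ge> c2 * \<epsilon> ^ (card (verts T) * (CARD('v) - 1)) \<and>
      measure prior {(\<rho>, \<pi>) \<in> space prior. \<forall>\<phi>\<in>maximal_paths T r. \<bar>\<pi> \<phi> - \<pi>0 \<phi>\<bar> \<le> \<epsilon>}
        \<ge> c3 * \<epsilon> ^ (card (maximal_paths T r) - 1) \<and>
      prob_space.indep_event prior
        {(\<rho>, \<pi>) \<in> space prior. \<forall>u\<in>verts T. norm (\<rho> u - \<rho>0 u) \<le> \<epsilon>}
        {(\<rho>, \<pi>) \<in> space prior. \<forall>\<phi>\<in>maximal_paths T r. \<bar>\<pi> \<phi> - \<pi>0 \<phi>\<bar> \<le> \<epsilon>}"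
  shows
    "(\<forall>n>0. \<forall>\<^sub>F C in at_top.
       vanishes_in_prob
         (\<lambda>m. Pi\<^sub>M (UNIV :: nat set) (\<lambda>_. doc_dist T r \<alpha> n (\<rho>0, \<pi>0)))
         (\<lambda>m X. posterior prior (doc_mass T r \<alpha>) m X
           (hellinger_far T r \<alpha> n (\<rho>0, \<pi>0) (C * sqrt (ln (real m) / real m)))))
     \<and>
     (\<forall>\<^sub>F C in at_top. \<forall>(ms :: nat \<Rightarrow> nat) (ns :: nat \<Rightarrow> nat).
       filterlim ms at_top sequentially \<and> filterlim ns at_top sequentially \<and>
       (\<lambda>k. ln (real (ns k))) \<in> o(\<lambda>k. real (ms k)) \<longrightarrow>
       vanishes_in_prob
         (\<lambda>k. Pi\<^sub>M (UNIV :: nat set) (\<lambda>_. doc_dist T r \<alpha> (ns k) (\<rho>0, \<pi>0)))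
         (\<lambda>k X. posterior prior (doc_mass T r \<alpha>) (ms k) X
           (hellinger_far T r \<alpha> (ns k) (\<rho>0, \<pi>0)
             (C * sqrt (ln (real (max (ms k) (ns k))) / real (ms k))))))"
proof -
  interpret directed_rooted_tree T r by fact
  interpret prior: prob_space prior by fact
  let ?D = "card (verts T) * (CARD('v) - 1) + (card (maximal_paths T r) - 1)"
  let ?d = "CARD('v) * card (verts T) + card (maximal_paths T r)"
  have fin: "finite (verts T)" by simp
  have "space prior = topic_params T r"
    using sets_eq_imp_space_eq[OF prior(2)] by (simp add: param_space_def space_restrict_space)
  then have \<omega>0: "(\<rho>0, \<pi>0) \<in> topic_params T r"
    using true_param by (simp add: measure_support_def)
  define c where "c = min c0 c1"
  have c: "c > 0" "\<And>u v. u \<in> verts T \<Longrightarrow> c \<le> \<rho>0 u $ v" "\<And>\<phi>. \<phi> \<in> maximal_paths T r \<Longrightarrow> c \<le> \<pi>0 \<phi>"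
    using pos bspec[OF bounded_below true_param] by (auto simp: c_def min_le_iff_disj)
  have mass: "\<forall>\<^sub>F \<epsilon> in at_right 0. \<exists>B\<in>sets prior. (c2 * c3) * \<epsilon> ^ ?D \<le> measure prior B \<and>
      (\<forall>(\<rho>, \<pi>)\<in>B. (\<forall>u\<in>verts T. norm (\<rho> u - \<rho>0 u) \<le> \<epsilon>) \<and>
        (\<forall>\<phi>\<in>maximal_paths T r. \<bar>\<pi> \<phi> - \<pi>0 \<phi>\<bar> \<le> \<epsilon>))"
    \<comment> \<open>Positivity of \<epsilon> is added because multiplying the two mass bounds
      requires nonnegative factors.\<close>
    using prior_mass eventually_at_right_less[of 0]
  proof eventually_elim
    case (elim \<epsilon>)
    let ?B1 = "{(\<rho>, \<pi>) \<in> space prior. \<forall>u\<in>verts T. norm (\<rho> u - \<rho>0 u) \<le> \<epsilon>}"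
    let ?B2 = "{(\<rho>, \<pi>) \<in> space prior. \<forall>\<phi>\<in>maximal_paths T r. \<bar>\<pi> \<phi> - \<pi>0 \<phi>\<bar> \<le> \<epsilon>}"
    have ind: "prior.indep_event ?B1 ?B2" using elim by blast
    have "(c2 * c3) * \<epsilon> ^ ?D
        = (c2 * \<epsilon> ^ (card (verts T) * (CARD('v) - 1))) * (c3 * \<epsilon> ^ (card (maximal_paths T r) - 1))"
      by (simp add: power_add)
    also have "\<dots> \<le> measure prior ?B1 * measure prior ?B2"
      using elim pos by (intro mult_mono) auto
    also have "\<dots> = measure prior (?B1 \<inter> ?B2)"
      using prior.prob_Int_of_indep_event(3)[OF ind] by (rule sym)
    finally show ?case
      using prior.prob_Int_of_indep_event(1,2)[OF ind] by (intro bexI[where x = "?B1 \<inter> ?B2"]) auto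
  qed
  have "c2 * c3 > 0" using pos by simp
  note vanishes = posterior_vanishes[OF pos(1) fin prior \<omega>0 c this mass]
  have large: "\<forall>\<^sub>F C in at_top. 1 + 2 * real ?D + 6 * real ?d \<le> C"
    by (rule eventually_ge_at_top)
  show ?thesis
  proof (intro conjI allI impI)
    fix n :: nat assume "n > 0"
    show "\<forall>\<^sub>F C in at_top.
       vanishes_in_prob
         (\<lambda>m. Pi\<^sub>M (UNIV :: nat set) (\<lambda>_. doc_dist T r \<alpha> n (\<rho>0, \<pi>0)))
         (\<lambda>m X. posterior prior (doc_mass T r \<alpha>) m X
           (hellinger_far T r \<alpha> n (\<rho>0, \<pi>0) (C * sqrt (ln (real m) / real m))))"
      using large
    proof eventually_elim
      case (elim C)
      \<comment> \<open>As n is fixed here, the constant n + 1 plays the part of \<open>a\<close>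
        and m that of \<open>Ns\<close>.\<close>
      have "real (m * (n + 1)) \<le> real (n + 1) * real m ^ 2" "real (n * m\<^sup>2 + 1) \<le> real (n + 1) * real m ^ 3"
        if "m \<ge> 1" for m
      proof -
        have "m \<le> m\<^sup>2" using that by (simp add: power2_eq_square)
        then have "m * (n + 1) \<le> (n + 1) * m\<^sup>2"
          by (subst mult.commute) (rule mult_le_mono2)
        then show "real (m * (n + 1)) \<le> real (n + 1) * real m ^ 2"
          unfolding of_nat_mult[symmetric] of_nat_power[symmetric] of_nat_le_iff .
        have "n * m\<^sup>2 \<le> n * m ^ 3" "1 \<le> m ^ 3"
          using that by (simp_all add: power_increasing)
        then have "n * m\<^sup>2 + 1 \<le> (n + 1) * m ^ 3"
          unfolding add_mult_distrib nat_mult_1 by (rule add_mono)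
        then show "real (n * m\<^sup>2 + 1) \<le> real (n + 1) * real m ^ 3"
          unfolding of_nat_mult[symmetric] of_nat_power[symmetric] of_nat_le_iff .
      qed
      then have ev: "\<forall>\<^sub>F m in sequentially. real (m * (n + 1)) \<le> real (n + 1) * real m ^ 2"
          "\<forall>\<^sub>F m in sequentially. real (n * m\<^sup>2 + 1) \<le> real (n + 1) * real m ^ 3"
        by (auto intro: eventually_sequentiallyI[of 1])
      show ?case
        by (rule vanishes[where ms = "\<lambda>m. m" and Ns = "\<lambda>m. m" and ns = "\<lambda>_. n" and a = "real (n + 1)"])
          (use \<open>n > 0\<close> ev elim filterlim_ident in \<open>simp_all\<close>)
    qed
  next
    show "\<forall>\<^sub>F C in at_top. \<forall>(ms :: nat \<Rightarrow> nat) (ns :: nat \<Rightarrow> nat).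
       filterlim ms at_top sequentially \<and> filterlim ns at_top sequentially \<and>
       (\<lambda>k. ln (real (ns k))) \<in> o(\<lambda>k. real (ms k)) \<longrightarrow>
       vanishes_in_prob
         (\<lambda>k. Pi\<^sub>M (UNIV :: nat set) (\<lambda>_. doc_dist T r \<alpha> (ns k) (\<rho>0, \<pi>0)))
         (\<lambda>k X. posterior prior (doc_mass T r \<alpha>) (ms k) X
           (hellinger_far T r \<alpha> (ns k) (\<rho>0, \<pi>0)
             (C * sqrt (ln (real (max (ms k) (ns k))) / real (ms k)))))"
      using large
    proof (eventually_elim, intro allI impI, elim conjE)
      fix C :: real and ms ns :: "nat \<Rightarrow> nat"
      assume C: "1 + 2 * real ?D + 6 * real ?d \<le> C"
        and ms: "filterlim ms at_top sequentially" and ns: "filterlim ns at_top sequentially"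
      define Ns where "Ns k = max (ms k) (ns k)" for k
      have ns1: "\<forall>\<^sub>F k in sequentially. 1 \<le> ns k"
        using ns unfolding filterlim_at_top by blast
      have Ns: "filterlim Ns at_top sequentially"
        by (rule filterlim_at_top_mono[OF ms]) (simp add: Ns_def)
      have ev1: "\<forall>\<^sub>F k in sequentially. real (ms k * (ns k + 1)) \<le> 2 * real (Ns k) ^ 2"
        using ns1
      proof eventually_elim
        case (elim k)
        \<comment> \<open>Since n is at least 1, n + 1 is at most twice the maximum; this is the
          origin of the constant 2.\<close>
        then have "ms k * (ns k + 1) \<le> Ns k * (2 * Ns k)"
          by (intro mult_mono) (auto simp: Ns_def)
        then have "real (ms k * (ns k + 1)) \<le> real (Ns k * (2 * Ns k))"
          unfolding of_nat_le_iff .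
        then show ?case by (simp add: power2_eq_square)
      qed
      have ev2: "\<forall>\<^sub>F k in sequentially. real (ns k * (ms k)\<^sup>2 + 1) \<le> 2 * real (Ns k) ^ 3"
        using ns1
      proof eventually_elim
        case (elim k)
        have "ns k * (ms k)\<^sup>2 \<le> Ns k * (Ns k)\<^sup>2"
          by (intro mult_mono power_mono) (auto simp: Ns_def)
        moreover have "1 \<le> Ns k * (Ns k)\<^sup>2"
          using elim by (simp add: Ns_def)
        ultimately have "real (ns k * (ms k)\<^sup>2 + 1) \<le> real (2 * (Ns k * (Ns k)\<^sup>2))"
          unfolding of_nat_le_iff by linarith
        then show ?case by (simp add: power2_eq_square power3_eq_cube)
      qed
      show "vanishes_in_prob
         (\<lambda>k. Pi\<^sub>M (UNIV :: nat set) (\<lambda>_. doc_dist T r \<alpha> (ns k) (\<rho>0, \<pi>0)))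
         (\<lambda>k X. posterior prior (doc_mass T r \<alpha>) (ms k) X
           (hellinger_far T r \<alpha> (ns k) (\<rho>0, \<pi>0)
             (C * sqrt (ln (real (max (ms k) (ns k))) / real (ms k)))))"
        unfolding Ns_def[symmetric]
        by (rule vanishes[OF _ _ ms _ Ns _ ev1 ev2 C]) (use ns1 in \<open>simp_all add: Suc_le_eq\<close>)
    qed
  qed
qed

end
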